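(* Consider a continuous first-price auction with $N\ge 2$ buyers, in quantile coordinates, with canonical equilibrium bidding strategy $\beta$. Let $M>0$ and let $\Lambda$ be a set of bidding profiles $\lambda=(\lambda_i)_{i\in[N]}$, $\lambda_i:[0,1]\to B$, containing the profile in which every buyer uses $\beta$, and such that every $\lambda\in\Lambda$ is symmetric ($\lambda_i=\lambda_j$ for all $i,j$), each $\lambda_i$ is strictly increasing and differentiable, $\lambda_i(0)=0$, and $\lambda_i<M$. For $\lambda\in\Lambda$ and $\theta_i\in[0,1]$ let $$\alpha(\theta_i|\lambda)=\theta_i^{N-2}\cdot\begin{cases}\frac{(\lambda_i(\theta_i)-\beta(\theta_i))^2}{2} & \lambda_i(\theta_i)\le\beta(1),\\ \frac{(\beta(1)-\beta(\theta_i))^2}{2}+(\beta(1)-\beta(\theta_i))(\lambda_i(\theta_i)-\beta(1)) & \lambda_i(\theta_i)>\beta(1).\end{cases}$$ Then $\epsilon(\theta_i)=\beta(1)-\beta(\theta_i)$ together with $\gamma=0$ is a feasible solution, of value $0$, of the infinite linear program $$\inf_{\epsilon\ge0,\ \gamma\in\mathbb{R}}\ \gamma\quad\text{s.t.}\quad \gamma+\sum_{i\in[N]}\int_0^1 d\theta_i\,\epsilon(\theta_i)\,\frac{1}{\theta_i}\left(U_i(\beta,\lambda_{-i}|\theta_i)-U_i(\lambda|\theta_i)\right)\ \ge\ \sum_{i\in[N]}\int_0^1 d\theta_i\,\alpha(\theta_i|\lambda)\quad\forall\,\lambda\in\Lambda .$$ As a consequence, if a Borel probability measure $\sigma$ on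 $\Lambda$ (with respect to the sup-norm topology) is a continuous Bayesian coarse correlated equilibrium, then $\sigma$ places probability $1$ on the equilibrium bidding strategies $\beta$.
   Context: Continuous auction in quantile coordinates. There are $N\ge2$ buyers with i.i.d. valuations drawn from a c.d.f. $F$ with a probability density of full support on the interval $V=[0,v(1)]\subset\mathbb{R}_+$; bids lie in an interval $B=[0,\max B]\supseteq V$. Set $v=F^{-1}:[0,1]\to V$, assumed continuous and strictly increasing on $[0,1]$ (so $v(0)=0$) and $C^\infty$ on $(0,1]$. Types $\theta_i$ are i.i.d. uniform on $[0,1]$, and a buyer of type $\theta_i$ has valuation $v(\theta_i)$. A bidding strategy of buyer $i$ is $\lambda_i:[0,1]\to B$, and $\lambda(\theta)=(\lambda_i(\theta_i))_i$. Allocation (uniform tie-breaking): $x_i(b)=1/|\arg\max_j b_j|$ if $i\in\arg\max_j b_j$, and $x_i(b)=0$ otherwise. First-price utility: $u_i(b|w)=x_i(b)(w-b_i)$ for valuation $w$. Expected utilities: $U_i(\lambda|\theta_i)=\int_{[0,1]^{N-1}}d\theta_{-i}\,u_i(\lambda(\theta)|v(\theta_i))$; $U_i(b',\lambda_{-i}|\theta_i)$ is the same with buyer $i$'s bid replaced by the constant $b'$; and $U_i(\beta,\lambda_{-i}|\theta_i):=U_i(\beta(\theta_i),\lambda_{-i}|\theta_i)$. Canonical first-price equilibrium: $\beta(0)=0$ and $\beta(\theta)=\frac{1}{\theta^{N-1}}\int_0^\theta (N-1)t^{N-2}v(t)\,dt$ for $\theta\in(0,1]$. In the dual program, $\epsilon$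 ranges over non-negative uniformly continuous functions on $(0,1]$. A continuous Bayesian coarse correlated equilibrium (BCCE) with support in $\Lambda$ is a Borel probability measure $\sigma$ on $\Lambda$ such that for all $i\in[N]$, $\theta_i\in[0,1]$, $b'_i\in B$: $\int_\Lambda d\sigma(\lambda)\left(U_i(b'_i,\lambda_{-i}|\theta_i)-U_i(\lambda|\theta_i)\right)\le0$. *)

theory Defs
  imports "HOL-Probability.Probability"
begin

section \<open>Valuations in quantile coordinates\<close>

text \<open>Infinitely differentiable on \<open>S\<close>; at a point of \<open>S\<close> that is an endpoint of the interval
  \<open>S\<close> the derivatives are one-sided.\<close>

definition smooth_on :: "real set \<Rightarrow> (real \<Rightarrow> real) \<Rightarrow> bool" where
  "smooth_on S f \<longleftrightarrow>
     (\<exists>g :: nat \<Rightarrow> real \<Rightarrow> real. (\<forall>x\<in>S. g 0 x = f x) \<and>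
        (\<forall>k. \<forall>x\<in>S. (g k has_real_derivative g (Suc k) x) (at x within S)))"

definition measure_supp :: "real measure \<Rightarrow> real set" where
  "measure_supp D = {x. \<forall>U. open U \<and> x \<in> U \<longrightarrow> emeasure D U > 0}"

text \<open>\<open>p\<close> is the density of the valuations, \<open>cdf (density lborel p)\<close> is their c.d.f. \<open>F\<close>,
  and \<open>v\<close> is the inverse of \<open>F\<close> restricted to \<open>V = [0, v 1]\<close>.\<close>

definition quantile_valuation :: "(real \<Rightarrow> real) \<Rightarrow> (real \<Rightarrow> real) \<Rightarrow> bool" where
  "quantile_valuation p v \<longleftrightarrow>
     p \<in> borel_measurable borel \<and> (\<forall>x. 0 \<le> p x) \<and>
     prob_space (density lborel p) \<and>
     measure_supp (density lborel p) = {0..v 1} \<and>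
     bij_betw v {0..1} {0..v 1} \<and>
     (\<forall>\<theta>\<in>{0..1}. cdf (density lborel p) (v \<theta>) = \<theta>) \<and>
     continuous_on {0..1} v \<and> strict_mono_on {0..1} v \<and> smooth_on {0<..1} v"

section \<open>The first-price auction\<close>

text \<open>Buyers are \<open>{..<N}\<close>; bid vectors and type vectors are functions on \<open>nat\<close> of which only
  the values on \<open>{..<N}\<close> matter.\<close>

definition winners :: "nat \<Rightarrow> (nat \<Rightarrow> real) \<Rightarrow> nat set" where
  "winners N b = {j. is_arg_max b (\<lambda>k. k < N) j}"

definition allocation :: "nat \<Rightarrow> nat \<Rightarrow> (nat \<Rightarrow> real) \<Rightarrow> real" where
  "allocation N i b = (if i \<in> winners N b then 1 / real (card (winners N b)) else 0)"

definition utility :: "nat \<Rightarrow> nat \<Rightarrow> (nat \<Rightarrow> real) \<Rightarrow> real \<Rightarrow> real" where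
  "utility N i b w = allocation N i b * (w - b i)"

type_synonym profile = "nat \<Rightarrow> real \<Rightarrow> real"

definition bids :: "profile \<Rightarrow> (nat \<Rightarrow> real) \<Rightarrow> nat \<Rightarrow> real" where
  "bids lam \<theta> = (\<lambda>j. lam j (\<theta> j))"

definition others_types :: "nat \<Rightarrow> nat \<Rightarrow> (nat \<Rightarrow> real) measure" where
  "others_types N i = Pi\<^sub>M ({..<N} - {i}) (\<lambda>_. restrict_space lborel {0..1})"

text \<open>\<open>U_i(lam | t)\<close>\<close>

definition exp_utility :: "nat \<Rightarrow> (real \<Rightarrow> real) \<Rightarrow> nat \<Rightarrow> profile \<Rightarrow> real \<Rightarrow> real" where
  "exp_utility N v i lam t =
     (\<integral>\<theta>. utility N i (bids lam (\<theta>(i := t))) (v t) \<partial>others_types N i)"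

text \<open>\<open>U_i(b, lam_{-i} | t)\<close>\<close>

definition dev_utility ::
    "nat \<Rightarrow> (real \<Rightarrow> real) \<Rightarrow> nat \<Rightarrow> real \<Rightarrow> profile \<Rightarrow> real \<Rightarrow> real" where
  "dev_utility N v i b lam t =
     (\<integral>\<theta>. utility N i ((bids lam (\<theta>(i := t)))(i := b)) (v t) \<partial>others_types N i)"

definition canonical_bid :: "nat \<Rightarrow> (real \<Rightarrow> real) \<Rightarrow> real \<Rightarrow> real" where
  "canonical_bid N v \<theta> =
     (if \<theta> = 0 then 0
      else 1 / \<theta> ^ (N - 1) * (LBINT t:{0..\<theta>}. real (N - 1) * t ^ (N - 2) * v t))"

section \<open>Bidding profiles and their sup-norm topology\<close>

text \<open>Strategies live on \<open>[0,1]\<close> and profiles on \<open>{..<N}\<close>. Both are represented by extensional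
  functions, so that profiles at sup-distance \<open>0\<close> are equal.\<close>

definition bid_profiles :: "nat \<Rightarrow> real \<Rightarrow> profile set" where
  "bid_profiles N bmax = {..<N} \<rightarrow>\<^sub>E ({0..1} \<rightarrow>\<^sub>E {0..bmax})"

definition canonical_profile :: "nat \<Rightarrow> (real \<Rightarrow> real) \<Rightarrow> profile" where
  "canonical_profile N v = (\<lambda>i\<in>{..<N}. \<lambda>\<theta>\<in>{0..1}. canonical_bid N v \<theta>)"

text \<open>Outside the carrier the distance is set to \<open>0\<close>, since \<open>Metric_space\<close> asks for
  nonnegativity and symmetry everywhere.\<close>

definition sup_dist :: "nat \<Rightarrow> profile set \<Rightarrow> profile \<Rightarrow> profile \<Rightarrow> real" where
  "sup_dist N L lam mu =
     (if lam \<in> L \<and> mu \<in> L then SUP (i, \<theta>)\<in>{..<N} \<times> {0..1}. \<bar>lam i \<theta> - mu i \<theta>\<bar> else 0)"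

definition sup_borel :: "nat \<Rightarrow> profile set \<Rightarrow> profile measure" where
  "sup_borel N L = sigma L {U. openin (Metric_space.mtopology L (sup_dist N L)) U}"

lemma Metric_space_sup_dist:
  assumes "0 < N" and L: "L \<subseteq> bid_profiles N bmax"
  shows "Metric_space L (sup_dist N L)"
proof -
  let ?I = "{..<N} \<times> {0..1::real}"
  let ?d = "\<lambda>lam mu. \<lambda>(i, \<theta>). \<bar>(lam :: profile) i \<theta> - mu i \<theta>\<bar>"
  have ne: "?I \<noteq> {}" and z: "(0, 0) \<in> ?I"
    using assms by auto
  have bnd: "\<bar>lam i \<theta> - mu i \<theta>\<bar> \<le> bmax"
    if "lam \<in> L" "mu \<in> L" "i < N" "\<theta> \<in> {0..1}" for lam mu i \<theta>
  proof -
    have "lam \<in> bid_profiles N bmax" "mu \<in> bid_profiles N bmax"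
      using that L by auto
    then have "lam i \<in> {0..1} \<rightarrow>\<^sub>E {0..bmax}" "mu i \<in> {0..1} \<rightarrow>\<^sub>E {0..bmax}"
      using that(3) by (simp_all add: bid_profiles_def PiE_iff)
    then have "lam i \<theta> \<in> {0..bmax}" "mu i \<theta> \<in> {0..bmax}"
      using that(4) by (simp_all add: PiE_iff)
    then show ?thesis by auto
  qed
  have bdd: "bdd_above (?d lam mu ` ?I)" if "lam \<in> L" "mu \<in> L" for lam mu
    using bnd[OF that] by (intro bdd_aboveI[of _ bmax]) auto
  have up: "\<bar>lam i \<theta> - mu i \<theta>\<bar> \<le> sup_dist N L lam mu"
    if "lam \<in> L" "mu \<in> L" "i < N" "\<theta> \<in> {0..1}" for lam mu i \<theta>
    using cSUP_upper[of "(i, \<theta>)" ?I "?d lam mu"] bdd[of lam mu] that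
    by (auto simp: sup_dist_def)
  have least: "sup_dist N L lam mu \<le> c"
    if "lam \<in> L" "mu \<in> L" "\<And>i \<theta>. i < N \<Longrightarrow> \<theta> \<in> {0..1} \<Longrightarrow> \<bar>lam i \<theta> - mu i \<theta>\<bar> \<le> c"
    for lam mu c
  proof -
    have "(SUP x\<in>?I. ?d lam mu x) \<le> c"
      by (rule cSUP_least[OF ne]) (use that(3) in auto)
    then show ?thesis using that(1,2) by (simp add: sup_dist_def)
  qed
  show ?thesis
  proof
    show "0 \<le> sup_dist N L lam mu" for lam mu
    proof (cases "lam \<in> L \<and> mu \<in> L")
      case True
      then show ?thesis
        using up[of lam mu 0 0] assms(1) abs_ge_zero[of "lam 0 0 - mu 0 0"] by simp
    next
      case False
      then show ?thesis by (auto simp: sup_dist_def)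
    qed
    show "sup_dist N L lam mu = sup_dist N L mu lam" for lam mu
      by (auto simp: sup_dist_def abs_minus_commute)
    show "(sup_dist N L lam mu = 0) = (lam = mu)" if "lam \<in> L" "mu \<in> L" for lam mu
    proof
      assume 0: "sup_dist N L lam mu = 0"
      have eq: "lam i \<theta> = mu i \<theta>" if "i < N" "\<theta> \<in> {0..1}" for i \<theta>
        using up[OF \<open>lam \<in> L\<close> \<open>mu \<in> L\<close> that] 0 by simp
      have P: "lam \<in> bid_profiles N bmax" "mu \<in> bid_profiles N bmax"
        using that L by auto
      show "lam = mu"
        using P unfolding bid_profiles_def
      proof (rule PiE_ext)
        fix i assume i: "i \<in> {..<N}"
        have "lam i \<in> {0..1} \<rightarrow>\<^sub>E {0..bmax}" "mu i \<in> {0..1} \<rightarrow>\<^sub>E {0..bmax}"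
          using P i by (simp_all add: bid_profiles_def PiE_iff)
        then show "lam i = mu i"
          by (rule PiE_ext) (use eq i in auto)
      qed
    next
      assume "lam = mu"
      then show "sup_dist N L lam mu = 0"
        using least[of lam mu 0] up[of lam mu 0 0] that assms(1) by simp
    qed
    show "sup_dist N L lam nu \<le> sup_dist N L lam mu + sup_dist N L mu nu"
      if "lam \<in> L" "mu \<in> L" "nu \<in> L" for lam mu nu
    proof (rule least[OF that(1,3)])
      fix i :: nat and \<theta> :: real assume "i < N" "\<theta> \<in> {0..1}"
      then show "\<bar>lam i \<theta> - nu i \<theta>\<bar> \<le> sup_dist N L lam mu + sup_dist N L mu nu"
        using up[OF that(1,2), of i \<theta>] up[OF that(2,3), of i \<theta>] by linarith
    qed
  qed
qed

definition continuous_BCCE ::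
    "nat \<Rightarrow> (real \<Rightarrow> real) \<Rightarrow> real \<Rightarrow> profile set \<Rightarrow> profile measure \<Rightarrow> bool" where
  "continuous_BCCE N v bmax L \<sigma> \<longleftrightarrow>
     prob_space \<sigma> \<and> space \<sigma> = L \<and> sets \<sigma> = sets (sup_borel N L) \<and>
     (\<forall>i<N. \<forall>t\<in>{0..1}. \<forall>b\<in>{0..bmax}.
        (\<integral>lam. (dev_utility N v i b lam t - exp_utility N v i lam t) \<partial>\<sigma>) \<le> 0)"

section \<open>The dual program\<close>

definition alpha :: "nat \<Rightarrow> (real \<Rightarrow> real) \<Rightarrow> nat \<Rightarrow> profile \<Rightarrow> real \<Rightarrow> real" where
  "alpha N v i lam \<theta> =
     (let \<beta> = canonical_bid N v in
      \<theta> ^ (N - 2) *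
      (if lam i \<theta> \<le> \<beta> 1 then (lam i \<theta> - \<beta> \<theta>)\<^sup>2 / 2
       else (\<beta> 1 - \<beta> \<theta>)\<^sup>2 / 2 + (\<beta> 1 - \<beta> \<theta>) * (lam i \<theta> - \<beta> 1)))"

definition dual_integrand ::
    "nat \<Rightarrow> (real \<Rightarrow> real) \<Rightarrow> (real \<Rightarrow> real) \<Rightarrow> nat \<Rightarrow> profile \<Rightarrow> real \<Rightarrow> real" where
  "dual_integrand N v \<epsilon> i lam \<theta> =
     \<epsilon> \<theta> * (1 / \<theta>) *
     (dev_utility N v i (canonical_bid N v \<theta>) lam \<theta> - exp_utility N v i lam \<theta>)"

text \<open>Integrability is part of feasibility, because the Lebesgue integral in HOL is \<open>0\<close> for
  non-integrable functions and the constraint would then be meaningless. The integrals over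
  \<open>[0,1]\<close> are taken over \<open>(0,1]\<close>, where \<open>\<epsilon>\<close> and \<open>1/\<theta>\<close> are defined.\<close>

definition dual_feasible ::
    "nat \<Rightarrow> (real \<Rightarrow> real) \<Rightarrow> profile set \<Rightarrow> ((real \<Rightarrow> real) \<times> real) set" where
  "dual_feasible N v L = {(\<epsilon>, \<gamma>).
     (\<forall>\<theta>\<in>{0<..1}. 0 \<le> \<epsilon> \<theta>) \<and> uniformly_continuous_on {0<..1} \<epsilon> \<and>
     (\<forall>lam\<in>L.
        (\<forall>i<N. set_integrable lborel {0<..1} (dual_integrand N v \<epsilon> i lam) \<and>
               set_integrable lborel {0<..1} (alpha N v i lam)) \<and>
        \<gamma> + (\<Sum>i<N. LBINT \<theta>:{0<..1}. dual_integrand N v \<epsilon> i lam \<theta>)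
          \<ge> (\<Sum>i<N. LBINT \<theta>:{0<..1}. alpha N v i lam \<theta>))}"

definition dual_objective :: "(real \<Rightarrow> real) \<times> real \<Rightarrow> real" where
  "dual_objective = (\<lambda>(\<epsilon>, \<gamma>). \<gamma>)"

end

theory Submission
  imports Defs
begin

text \<open>
  Since \<open>\<beta>' = (N - 1) (v - \<beta>) / \<theta>\<close>, the weight \<open>\<epsilon>(\<theta>) / \<theta>\<close> turns the gain from deviating to \<open>\<beta>\<close>
  into \<open>(\<beta> 1 - \<beta> \<theta>) \<beta>' \<theta> w(\<theta>)^(N - 1) / (N - 1)\<close>, where \<open>w(\<theta>)\<close> is the measure of the types \<open>s\<close>
  with \<open>l s < \<beta> \<theta>\<close> and \<open>l\<close> is the common strategy. Writing \<open>w^(N - 1) / (N - 1)\<close> as the integral of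
  \<open>s^(N - 2)\<close> over these types and exchanging the two integrals, the inner one becomes elementary,
  and the dual constraint holds with equality for every \<open>l\<close>. Integrating the equilibrium constraints
  against this weight therefore bounds the nonnegative expectation of \<open>\<integral> \<alpha>\<close> by \<open>0\<close>, so almost every
  profile has \<open>\<alpha> = 0\<close> almost everywhere, and by continuity it is the canonical one.
\<close>

section \<open>Fundamental theorem of calculus on an open interval\<close>

text \<open>Integrability is part of the conclusion: a nonnegative derivative of a function
  continuous up to the endpoints is integrable even if it is unbounded near them. This matters
  because the derivative of \<beta> may blow up at 0, for instance when \<open>v\<close> behaves
  like a square root there.\<close>

lemma has_bochner_integral_FTC_interior:
  fixes f F :: "real \<Rightarrow> real"
  assumes "a \<le> b" and F: "continuous_on {a..b} F"
    and D: "\<And>x. a < x \<Longrightarrow> x < b \<Longrightarrow> DERIV F x :> f x"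
    and f: "\<And>x. a < x \<Longrightarrow> x < b \<Longrightarrow> isCont f x"
    and nonneg: "\<And>x. a < x \<Longrightarrow> x < b \<Longrightarrow> 0 \<le> f x"
  shows "has_bochner_integral lborel (\<lambda>x. indicator {a<..<b} x * f x) (F b - F a)"
proof (cases "a = b")
  case True
  then show ?thesis by (simp add: has_bochner_integral_zero)
next
  case False
  with \<open>a \<le> b\<close> have ab: "a < b" by simp
  have lim: "((F \<circ> real_of_ereal) \<longlongrightarrow> F a) (at_right (ereal a))"
    "((F \<circ> real_of_ereal) \<longlongrightarrow> F b) (at_left (ereal b))"
    using continuous_on_Icc_at_rightD[OF F ab] continuous_on_Icc_at_leftD[OF F ab]
    by (simp_all add: ereal_tendsto_simps)
  have "set_integrable lborel (einterval a b) f" "(LBINT x=a..b. f x) = F b - F a"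
    by (rule interval_integral_FTC_nonneg[where F = F]; use ab D f nonneg lim in auto)+
  then show ?thesis
    using ab by (auto simp: has_bochner_integral_iff interval_lebesgue_integral_def
        set_integrable_def set_lebesgue_integral_def)
qed

lemma nn_integral_has_bochner_integral:
  fixes f :: "'a \<Rightarrow> real"
  assumes "has_bochner_integral M f x" "\<And>y. y \<in> space M \<Longrightarrow> 0 \<le> f y"
  shows "(\<integral>\<^sup>+y. ennreal (f y) \<partial>M) = ennreal x"
  using assms by (metis AE_I2 has_bochner_integral_iff nn_integral_eq_integral)

section \<open>The canonical equilibrium\<close>

locale first_price =
  fixes N :: nat and v :: "real \<Rightarrow> real"
  assumes N: "2 \<le> N" and v0: "v 0 = 0"
    and cont_v: "continuous_on {0..1} v" and mono_v: "strict_mono_on {0..1} v"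
begin

abbreviation \<beta> :: "real \<Rightarrow> real" where "\<beta> \<equiv> canonical_bid N v"

text \<open>The derivative of \<beta> on (0, 1), obtained by differentiating
  \<open>\<theta> ^ (N - 1) * \<beta> \<theta>\<close>; see \<open>beta_deriv\<close>.\<close>

definition slope :: "real \<Rightarrow> real" where "slope \<theta> = real (N - 1) * (v \<theta> - \<beta> \<theta>) / \<theta>"

text \<open>On (0, 1] this is \<open>x ^ (N - 1) * \<beta> x\<close>. The gauge integral makes its
  derivative available up to both endpoints.\<close>

definition cumul :: "real \<Rightarrow> real" where
  "cumul x = integral {0..x} (\<lambda>t. real (N - 1) * t ^ (N - 2) * v t)"

lemma v_less: "0 \<le> s \<Longrightarrow> s < t \<Longrightarrow> t \<le> 1 \<Longrightarrow> v s < v t"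
  using strict_mono_onD[OF mono_v] by auto

lemma v_le: "0 \<le> s \<Longrightarrow> s \<le> t \<Longrightarrow> t \<le> 1 \<Longrightarrow> v s \<le> v t"
  using v_less[of s t] by (cases "s = t") auto

lemma v_nonneg: "0 \<le> t \<Longrightarrow> t \<le> 1 \<Longrightarrow> 0 \<le> v t"
  using v_le[of 0 t] v0 by simp

lemma cont_integrand: "continuous_on {0..1} (\<lambda>t. real (N - 1) * t ^ (N - 2) * v t)"
  by (intro continuous_intros cont_v)

lemma cumul_deriv:
  "x \<in> {0..1} \<Longrightarrow>
    (cumul has_real_derivative real (N - 1) * x ^ (N - 2) * v x) (at x within {0..1})"
  using integral_has_real_derivative[OF cont_integrand] unfolding cumul_def by simp

lemma cumul_deriv_interior:
  "0 < x \<Longrightarrow> x < 1 \<Longrightarrow> DERIV cumul x :> real (N - 1) * x ^ (N - 2) * v x"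
  using cumul_deriv[of x] at_within_Icc_at[of 0 x 1] by simp

lemma cont_cumul: "continuous_on {0..1} cumul"
  using cumul_deriv by (meson DERIV_continuous continuous_on_eq_continuous_within)

lemma cumul_0: "cumul 0 = 0" by (simp add: cumul_def)

lemma beta_0: "\<beta> 0 = 0" by (simp add: canonical_bid_def)

lemma beta_eq:
  assumes "0 < \<theta>" "\<theta> \<le> 1"
  shows "\<beta> \<theta> = cumul \<theta> / \<theta> ^ (N - 1)"
proof -
  have "set_integrable lborel {0..\<theta>} (\<lambda>t. real (N - 1) * t ^ (N - 2) * v t)"
    using assms by (intro borel_integrable_atLeastAtMost' continuous_on_subset[OF cont_integrand]) auto
  from set_borel_integral_eq_integral(2)[OF this] show ?thesis
    using assms by (simp add: canonical_bid_def cumul_def)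
qed

lemma power_N: "x ^ (N - 1) = x * x ^ (N - 2)" for x :: real
  using N by (metis Suc_diff_Suc Suc_1 less_eq_Suc_le power_Suc)

lemma beta_pos:
  assumes "0 < \<theta>" "\<theta> \<le> 1"
  shows "0 < \<beta> \<theta>"
proof -
  have "cumul 0 < cumul \<theta>"
  proof (rule DERIV_pos_imp_increasing_open[where f = cumul])
    fix x assume "0 < x" "x < \<theta>"
    then show "\<exists>y. DERIV cumul x :> y \<and> 0 < y"
      using assms cumul_deriv_interior[of x] v_less[of 0 x] v0 N
      by (intro exI[of _ "real (N - 1) * x ^ (N - 2) * v x"]) auto
  qed (use assms in \<open>auto intro: continuous_on_subset[OF cont_cumul]\<close>)
  then show ?thesis using assms by (simp add: beta_eq cumul_0)
qed

lemma beta_nonneg: "0 \<le> \<theta> \<Longrightarrow> \<theta> \<le> 1 \<Longrightarrow> 0 \<le> \<beta> \<theta>"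
  using beta_pos[of \<theta>] beta_0 by (cases "\<theta> = 0") auto

text \<open>\<open>\<beta> \<theta>\<close> is the average of \<open>v\<close> over [0, \<theta>]
  with density proportional to \<open>t ^ (N - 2)\<close>, and \<open>v\<close> stays strictly below
  \<open>v \<theta>\<close> before \<theta>. In the proof, \<open>?H\<close> compares the integrals
  of the constant \<open>v \<theta>\<close> and of \<open>v\<close> against this weight.\<close>

lemma beta_less_v:
  assumes "0 < \<theta>" "\<theta> \<le> 1"
  shows "\<beta> \<theta> < v \<theta>"
proof -
  let ?H = "\<lambda>x. v \<theta> * x ^ (N - 1) - cumul x"
  have "?H 0 < ?H \<theta>"
  proof (rule DERIV_pos_imp_increasing_open[where f = ?H])
    fix x assume x: "0 < x" "x < \<theta>"
    have "N - 1 - 1 = N - 2" using N by simp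
    then have "DERIV ?H x :> v \<theta> * (real (N - 1) * x ^ (N - 2)) - real (N - 1) * x ^ (N - 2) * v x"
      using x assms by (auto intro!: derivative_eq_intros cumul_deriv_interior)
    moreover have "real (N - 1) * x ^ (N - 2) * v x < v \<theta> * (real (N - 1) * x ^ (N - 2))"
      using mult_strict_left_mono[OF v_less[of x \<theta>], of "real (N - 1) * x ^ (N - 2)"] x assms N
      by (simp only: mult_ac) simp
    ultimately show "\<exists>y. DERIV ?H x :> y \<and> 0 < y"
      by (intro exI conjI) (assumption, simp only: diff_gt_0_iff_gt)
  qed (use assms in \<open>auto intro!: continuous_intros continuous_on_subset[OF cont_cumul]\<close>)
  moreover have "N - 1 \<noteq> 0" using N by simp
  ultimately show ?thesis
    using assms by (simp add: beta_eq cumul_0 power_0_left pos_divide_less_eq del: One_nat_def)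
qed

lemma beta_le_v: "0 \<le> \<theta> \<Longrightarrow> \<theta> \<le> 1 \<Longrightarrow> \<beta> \<theta> \<le> v \<theta>"
  using beta_less_v[of \<theta>] beta_0 v0 by (cases "\<theta> = 0") auto

lemma slope_pos: "0 < \<theta> \<Longrightarrow> \<theta> \<le> 1 \<Longrightarrow> 0 < slope \<theta>"
  using beta_less_v[of \<theta>] N by (simp add: slope_def)

lemma beta_deriv:
  assumes "0 < \<theta>" "\<theta> < 1"
  shows "DERIV \<beta> \<theta> :> slope \<theta>"
proof -
  have "N - 1 - 1 = N - 2" using N by simp
  then have "DERIV (\<lambda>x. cumul x / x ^ (N - 1)) \<theta> :>
      (real (N - 1) * \<theta> ^ (N - 2) * v \<theta> * \<theta> ^ (N - 1) - cumul \<theta> * (real (N - 1) * \<theta> ^ (N - 2)))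
        / (\<theta> ^ (N - 1) * \<theta> ^ (N - 1))"
    using assms by (auto intro!: derivative_eq_intros cumul_deriv_interior)
  also have "(real (N - 1) * \<theta> ^ (N - 2) * v \<theta> * \<theta> ^ (N - 1) - cumul \<theta> * (real (N - 1) * \<theta> ^ (N - 2)))
        / (\<theta> ^ (N - 1) * \<theta> ^ (N - 1)) = slope \<theta>"
    unfolding slope_def beta_eq[OF assms(1) less_imp_le[OF assms(2)]] power_N
    using assms by (simp add: field_simps)
  finally have "DERIV (\<lambda>x. cumul x / x ^ (N - 1)) \<theta> :> slope \<theta>" .
  moreover have "\<forall>\<^sub>F x in nhds \<theta>. \<beta> x = cumul x / x ^ (N - 1)"
    using eventually_nhds_in_open[of "{0<..<1}" \<theta>] assms
    by (auto elim!: eventually_mono simp: beta_eq)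
  ultimately show ?thesis by (subst DERIV_cong_ev) auto
qed

lemma cont_beta: "continuous_on {0..1} \<beta>"
proof -
  have "continuous (at \<theta> within {0..1}) \<beta>" if \<theta>: "\<theta> \<in> {0..1}" for \<theta>
  proof (cases "\<theta> = 0")
    case True
    \<comment> \<open>The quotient formula says nothing at 0, so \<beta> is squeezed there between 0
      and \<open>v\<close>.\<close>
    have "(\<beta> \<longlongrightarrow> 0) (at 0 within {0..1})"
    proof (rule tendsto_sandwich[of "\<lambda>_. 0" _ _ v])
      show "(v \<longlongrightarrow> 0) (at 0 within {0..1})"
        using cont_v v0 by (metis continuous_on_def atLeastAtMost_iff order_refl zero_le_one)
    qed (auto simp: eventually_at_filter beta_nonneg beta_le_v)
    then show ?thesis using True by (simp add: continuous_within beta_0)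
  next
    case False
    have "continuous (at \<theta> within {0..1}) (\<lambda>x. cumul x / x ^ (N - 1))"
      using cont_cumul \<theta> False
      by (intro continuous_intros) (auto simp: continuous_on_eq_continuous_within)
    moreover have "\<forall>\<^sub>F x in at \<theta> within {0..1}. cumul x / x ^ (N - 1) = \<beta> x"
      using eventually_nhds_in_open[of "{0<..}" \<theta>] \<theta> False
      by (auto simp: eventually_at_filter beta_eq elim!: eventually_mono)
    ultimately show ?thesis
      using \<theta> False by (auto simp: continuous_within beta_eq intro: Lim_transform_eventually)
  qed
  then show ?thesis by (simp add: continuous_on_eq_continuous_within)
qed

lemma beta_less:
  assumes "0 \<le> s" "s < t" "t \<le> 1"
  shows "\<beta> s < \<beta> t"
proof (rule DERIV_pos_imp_increasing_open[where f = \<beta>])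
  fix x assume "s < x" "x < t"
  then show "\<exists>y. DERIV \<beta> x :> y \<and> 0 < y"
    using assms by (intro exI[of _ "slope x"]) (simp add: beta_deriv slope_pos)
qed (use assms in \<open>auto intro: continuous_on_subset[OF cont_beta]\<close>)

lemma beta_le: "0 \<le> s \<Longrightarrow> s \<le> t \<Longrightarrow> t \<le> 1 \<Longrightarrow> \<beta> s \<le> \<beta> t"
  using beta_less[of s t] by (cases "s = t") auto

lemma strict_mono_beta: "strict_mono_on {0..1} \<beta>"
  by (auto intro!: strict_mono_onI beta_less)

section \<open>Integration over the types in (0, 1]\<close>

abbreviation R :: "real measure" where "R \<equiv> restrict_space lborel {0<..1}"

lemma borel_measurable_R:
  fixes f :: "real \<Rightarrow> real"
  shows "continuous_on {0<..1} f \<Longrightarrow> f \<in> borel_measurable R"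
  using borel_measurable_continuous_on_restrict[of "{0<..1}" f]
  by (simp add: measurable_def space_restrict_space sets_restrict_space)

lemma measurable_ident_R [measurable]: "(\<lambda>x. x) \<in> borel_measurable R"
  by (intro borel_measurable_R continuous_intros)

lemma measurable_beta [measurable]: "\<beta> \<in> borel_measurable R"
  by (intro borel_measurable_R continuous_on_subset[OF cont_beta]) auto

lemma measurable_v [measurable]: "v \<in> borel_measurable R"
  by (intro borel_measurable_R continuous_on_subset[OF cont_v]) auto

lemma measurable_slope [measurable]: "slope \<in> borel_measurable R"
  unfolding slope_def
  by (intro borel_measurable_R continuous_intros continuous_on_subset[OF cont_v]
      continuous_on_subset[OF cont_beta]) auto

text \<open>\<open>(\<beta> 1 - \<beta> \<theta>) * slope \<theta>\<close> is the derivative of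
  \<open>- (\<beta> 1 - \<beta> \<theta>)^2 / 2\<close>, and since \<beta> increases, the condition
  \<open>c < \<beta> \<theta>\<close> selects the types above the \<open>a\<close> with
  \<open>\<beta> a = c\<close>. The \<open>max\<close> covers values \<open>c\<close> above
  \<open>\<beta> 1\<close>, which \<beta> never exceeds.\<close>

lemma integral_slope:
  assumes "0 \<le> c"
  shows "has_bochner_integral R (\<lambda>\<theta>. if c < \<beta> \<theta> then (\<beta> 1 - \<beta> \<theta>) * slope \<theta> else 0)
    ((max 0 (\<beta> 1 - c))\<^sup>2 / 2)"
proof (cases "c \<le> \<beta> 1")
  case True
  then obtain a where a: "0 \<le> a" "a \<le> 1" "\<beta> a = c"
    using IVT'[of \<beta> 0 c 1] assms cont_beta beta_0 by auto
  let ?F = "\<lambda>\<theta>. - (\<beta> 1 - \<beta> \<theta>)\<^sup>2 / 2"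
  have cb: "isCont \<beta> x" if "0 < x" "x < 1" for x
    using beta_deriv[OF that] by (rule DERIV_isCont)
  have cv: "isCont v x" if "0 < x" "x < 1" for x
    using continuous_on_interior[OF cont_v] that by auto
  have hb: "has_bochner_integral lborel
      (\<lambda>x. indicator {a<..<1} x * ((\<beta> 1 - \<beta> x) * slope x)) (?F 1 - ?F a)"
  proof (rule has_bochner_integral_FTC_interior)
    show "continuous_on {a..1} ?F"
      using a by (intro continuous_intros continuous_on_subset[OF cont_beta]) auto
    fix x assume x: "a < x" "x < 1"
    show "DERIV ?F x :> (\<beta> 1 - \<beta> x) * slope x"
      using a x by (auto intro!: derivative_eq_intros beta_deriv)
    show "isCont (\<lambda>x. (\<beta> 1 - \<beta> x) * slope x) x"
      unfolding slope_def using a x by (intro continuous_intros cb cv) auto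
    show "0 \<le> (\<beta> 1 - \<beta> x) * slope x"
      using a x beta_le[of x 1] slope_pos[of x] by simp
  qed (use a in auto)
  have val: "?F 1 - ?F a = (max 0 (\<beta> 1 - c))\<^sup>2 / 2"
    using True a by (simp add: max_def)
  \<comment> \<open>The comparison leaves out the single point 1, which belongs to (0, 1] but not to
    the open interval used for the antiderivative.\<close>
  have ae: "AE x in lborel. indicator {a<..<1} x * ((\<beta> 1 - \<beta> x) * slope x) =
      indicator {0<..1} x *\<^sub>R (if c < \<beta> x then (\<beta> 1 - \<beta> x) * slope x else 0)"
  proof -
    have "c < \<beta> x \<longleftrightarrow> a < x" if "0 < x" "x < 1" for x
      using a that beta_less[of a x] beta_le[of x a] by (cases "a < x") auto
    then show ?thesis
      using AE_lborel_singleton[of 1] a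
      by (auto elim!: eventually_mono simp: indicator_def)
  qed
  have meas: "(\<lambda>x. indicator {0<..1} x *\<^sub>R (if c < \<beta> x then (\<beta> 1 - \<beta> x) * slope x else 0)) \<in> borel_measurable lborel"
    by (subst borel_measurable_restrict_space_iff[symmetric], simp, measurable)
  show ?thesis
    unfolding val[symmetric]
    by (subst has_bochner_integral_restrict_space, simp)
      (rule has_bochner_integral_cong_AE[THEN iffD1,
        OF borel_measurable_has_bochner_integral[OF hb] meas ae hb])
next
  case False
  have "has_bochner_integral R (\<lambda>\<theta>. 0::real) 0" by (rule has_bochner_integral_zero)
  moreover have "has_bochner_integral R (\<lambda>\<theta>. 0::real) 0 \<longleftrightarrow> ?thesis"
  proof (intro has_bochner_integral_cong refl)
    fix x assume "x \<in> space R"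
    then have "\<beta> x \<le> \<beta> 1" using beta_le[of x 1] by (simp add: space_restrict_space)
    then show "0 = (if c < \<beta> x then (\<beta> 1 - \<beta> x) * slope x else 0)" using False by simp
  qed (use False in simp)
  ultimately show ?thesis by simp
qed

sublocale R: prob_space R
  by (rule prob_spaceI) (simp add: emeasure_restrict_space space_restrict_space)

end

section \<open>Symmetric profiles of increasing strategies\<close>

lemma winners_iff: "j \<in> winners N b \<longleftrightarrow> j < N \<and> (\<forall>k<N. b k \<le> b j)"
  unfolding winners_def is_arg_max_def by (auto intro: leI dest: leD)

text \<open>\<open>l\<close> is the strategy shared by all buyers. The assumptions also hold for
  \<beta>, so every result about \<open>l\<close> can be specialised to the equilibrium
  profile.\<close>

locale monotone_strategy = first_price +
  fixes l :: "real \<Rightarrow> real"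
  assumes mono_l: "strict_mono_on {0..1} l" and l0: "l 0 = 0"
begin

lemma l_less: "0 \<le> s \<Longrightarrow> s < t \<Longrightarrow> t \<le> 1 \<Longrightarrow> l s < l t"
  using strict_mono_onD[OF mono_l] by auto

lemma l_le: "0 \<le> s \<Longrightarrow> s \<le> t \<Longrightarrow> t \<le> 1 \<Longrightarrow> l s \<le> l t"
  using l_less[of s t] by (cases "s = t") auto

lemma l_nonneg: "0 \<le> t \<Longrightarrow> t \<le> 1 \<Longrightarrow> 0 \<le> l t"
  using l_le[of 0 t] l0 by simp

lemma measurable_l [measurable]: "l \<in> borel_measurable R"
proof -
  have "mono_on {0<..1} l" by (auto intro!: mono_onI l_le)
  from borel_measurable_mono_on_fnc[OF this] show ?thesis
    by (simp add: measurable_def space_restrict_space sets_restrict_space)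
qed

section \<open>The probability of outbidding an opponent\<close>

text \<open>The probability that the bid \<open>b\<close> strictly beats one given opponent. By
  \<open>le_win\<close> and \<open>win_le\<close> it is a generalised inverse of
  \<open>l\<close>.\<close>

definition win :: "real \<Rightarrow> real" where "win b = measure lborel {s \<in> {0..1}. l s < b}"

lemma fmeasurable_Icc: "{0..s::real} \<in> fmeasurable lborel"
  by (rule fmeasurableI) (auto simp: emeasure_lborel_Icc_eq)

lemma sets_win: "{s \<in> {0..1}. l s < b} \<in> sets lborel"
proof -
  have "z \<in> {s \<in> {0..1}. l s < b}"
    if "x \<in> {s \<in> {0..1}. l s < b}" "y \<in> {s \<in> {0..1}. l s < b}" "x \<le> z" "z \<le> y" for x y z
    using that l_le[of z y] by auto
  then have "is_interval {s \<in> {0..1}. l s < b}"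
    unfolding is_interval_1 by blast
  then show ?thesis
    using real_interval_borel_measurable by simp
qed

lemma fmeasurable_win: "{s \<in> {0..1}. l s < b} \<in> fmeasurable lborel"
  by (rule fmeasurableI2[OF fmeasurable_Icc[of 1] _ sets_win]) auto

lemma le_win:
  assumes "0 \<le> s" "s \<le> 1" "l s < b"
  shows "s \<le> win b"
proof -
  have "x \<in> {s \<in> {0..1}. l s < b}" if "x \<in> {0..s}" for x
    using that assms l_le[of x s] by auto
  then have "measure lborel {0..s} \<le> win b"
    unfolding win_def by (intro measure_mono_fmeasurable fmeasurable_win) auto
  then show ?thesis using assms by simp
qed

lemma win_le:
  assumes "0 \<le> s" "s \<le> 1" "b \<le> l s"
  shows "win b \<le> s"
proof -
  have "x \<in> {0..s}" if "x \<in> {s \<in> {0..1}. l s < b}" for x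
    using that assms l_le[of s x] by (cases "x \<le> s") auto
  then have "win b \<le> measure lborel {0..s}"
    unfolding win_def by (intro measure_mono_fmeasurable fmeasurable_Icc sets_win) auto
  then show ?thesis using assms by simp
qed

lemma win_nonneg: "0 \<le> win b" by (simp add: win_def)

lemma win_le_1: "win b \<le> 1"
proof -
  have "win b \<le> measure lborel {0..1::real}"
    unfolding win_def
    by (rule measure_mono_fmeasurable[OF _ sets_win fmeasurable_Icc]) auto
  then show ?thesis by simp
qed

lemma win_own: "0 \<le> t \<Longrightarrow> t \<le> 1 \<Longrightarrow> win (l t) = t"
proof -
  assume t: "0 \<le> t" "t \<le> 1"
  have "s < t" if "l s < l t" "s \<in> {0..1}" for s
    using l_le[of t s] t that by force
  then have "{s \<in> {0..1}. l s < l t} = {0..<t}" using t l_less[of _ t] by auto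
  then show ?thesis using t by (simp add: win_def)
qed

lemma mono_win: "b \<le> c \<Longrightarrow> win b \<le> win c"
  unfolding win_def
  by (rule measure_mono_fmeasurable[OF _ fmeasurableD[OF fmeasurable_win] fmeasurable_win]) auto

lemma measurable_win [measurable]: "(\<lambda>\<theta>. win (\<beta> \<theta>)) \<in> borel_measurable R"
proof -
  have "win \<in> borel_measurable borel"
    by (rule borel_measurable_mono) (simp add: mono_def mono_win)
  then show ?thesis by measurable
qed

text \<open>By \<open>le_win\<close> and \<open>win_le\<close>, the types in (0, 1] with
  \<open>l s < b\<close> form the interval from 0 to \<open>win b\<close>, up to the single type
  \<open>win b\<close>.\<close>

lemma integral_power_win:
  "has_bochner_integral R (\<lambda>s. if l s < b then s ^ (N - 2) else 0) (win b ^ (N - 1) / real (N - 1))"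
proof -
  let ?F = "\<lambda>s::real. s ^ (N - 1) / real (N - 1)"
  have hb: "has_bochner_integral lborel (\<lambda>s. indicator {0<..<win b} s * s ^ (N - 2)) (?F (win b) - ?F 0)"
  proof (rule has_bochner_integral_FTC_interior)
    have "N - 1 - 1 = N - 2" using N by simp
    then show "DERIV ?F x :> x ^ (N - 2)" for x
      using N by (auto intro!: derivative_eq_intros)
  qed (use N in \<open>auto intro!: win_nonneg continuous_intros\<close>)
  have meas: "(\<lambda>s. indicator {0<..1} s *\<^sub>R (if l s < b then s ^ (N - 2) else 0)) \<in> borel_measurable lborel"
    by (subst borel_measurable_restrict_space_iff[symmetric], simp, measurable)
  have ae: "AE s in lborel. indicator {0<..<win b} s * s ^ (N - 2) =
      indicator {0<..1} s *\<^sub>R (if l s < b then s ^ (N - 2) else 0)"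
  proof -
    have "indicator {0<..<win b} s * s ^ (N - 2) =
      indicator {0<..1} s *\<^sub>R (if l s < b then s ^ (N - 2) else 0)" if "s \<noteq> win b" for s
      using that le_win[of s b] win_le[of s b] win_le_1[of b]
      by (auto simp: indicator_def not_less)
    then show ?thesis using AE_lborel_singleton[of "win b"] by (rule eventually_mono[rotated])
  qed
  have val: "?F (win b) - ?F 0 = win b ^ (N - 1) / real (N - 1)" using N by simp
  show ?thesis
    by (subst has_bochner_integral_restrict_space, simp)
      (rule has_bochner_integral_cong_AE[THEN iffD1,
        OF borel_measurable_has_bochner_integral[OF hb] meas ae hb, unfolded val])
qed

text \<open>The nonnegative kernel \<open>(\<beta> 1 - \<beta> \<theta>) * slope \<theta> * s ^ (N -
  2)\<close> on the pairs with \<open>l s < \<beta> \<theta>\<close> is integrated in both orders: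
  over \<open>s\<close> first by \<open>integral_power_win\<close> with
  \<open>b = \<beta> \<theta>\<close>, over \<theta> first by \<open>integral_slope\<close> with
  \<open>c = l s\<close>. The latter order leaves a bounded integrand, so both double integrals are
  finite.\<close>

lemma integral_deviation:
  "has_bochner_integral R
     (\<lambda>\<theta>. (\<beta> 1 - \<beta> \<theta>) * slope \<theta> * (win (\<beta> \<theta>) ^ (N - 1) / real (N - 1)))
     (\<integral>s. s ^ (N - 2) * ((max 0 (\<beta> 1 - l s))\<^sup>2 / 2) \<partial>R)"
  and integrable_deviation:
  "integrable R (\<lambda>s. s ^ (N - 2) * ((max 0 (\<beta> 1 - l s))\<^sup>2 / 2))"
proof -
  interpret RR: pair_sigma_finite R R ..
  let ?K = "\<lambda>\<theta> s. ennreal (if l s < \<beta> \<theta> then (\<beta> 1 - \<beta> \<theta>) * slope \<theta> * s ^ (N - 2) else 0)"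
  have pos: "0 \<le> (\<beta> 1 - \<beta> \<theta>) * slope \<theta>" if "\<theta> \<in> {0<..1}" for \<theta>
    using that beta_le[of \<theta> 1] slope_pos[of \<theta>] by simp
  have inner_s: "(\<integral>\<^sup>+s. ?K \<theta> s \<partial>R) =
      ennreal ((\<beta> 1 - \<beta> \<theta>) * slope \<theta> * (win (\<beta> \<theta>) ^ (N - 1) / real (N - 1)))"
    if \<theta>: "\<theta> \<in> {0<..1}" for \<theta>
  proof -
    have hb: "has_bochner_integral R
        (\<lambda>s. (\<beta> 1 - \<beta> \<theta>) * slope \<theta> * (if l s < \<beta> \<theta> then s ^ (N - 2) else 0))
        ((\<beta> 1 - \<beta> \<theta>) * slope \<theta> * (win (\<beta> \<theta>) ^ (N - 1) / real (N - 1)))"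
      by (intro has_bochner_integral_mult_right integral_power_win)
    then have "(\<integral>\<^sup>+s. ennreal ((\<beta> 1 - \<beta> \<theta>) * slope \<theta> * (if l s < \<beta> \<theta> then s ^ (N - 2) else 0)) \<partial>R) =
      ennreal ((\<beta> 1 - \<beta> \<theta>) * slope \<theta> * (win (\<beta> \<theta>) ^ (N - 1) / real (N - 1)))"
      by (rule nn_integral_has_bochner_integral) (use pos \<theta> in \<open>auto simp: space_restrict_space\<close>)
    moreover have "(\<integral>\<^sup>+s. ?K \<theta> s \<partial>R) = (\<integral>\<^sup>+s. ennreal ((\<beta> 1 - \<beta> \<theta>) * slope \<theta> * (if l s < \<beta> \<theta> then s ^ (N - 2) else 0)) \<partial>R)"
      by (intro nn_integral_cong) auto
    ultimately show ?thesis by simp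
  qed
  have inner_t: "(\<integral>\<^sup>+\<theta>. ?K \<theta> s \<partial>R) = ennreal (s ^ (N - 2) * ((max 0 (\<beta> 1 - l s))\<^sup>2 / 2))"
    if s: "s \<in> {0<..1}" for s
  proof -
    have hb: "has_bochner_integral R
        (\<lambda>\<theta>. s ^ (N - 2) * (if l s < \<beta> \<theta> then (\<beta> 1 - \<beta> \<theta>) * slope \<theta> else 0))
        (s ^ (N - 2) * ((max 0 (\<beta> 1 - l s))\<^sup>2 / 2))"
      using s by (intro has_bochner_integral_mult_right integral_slope l_nonneg) auto
    then have "(\<integral>\<^sup>+\<theta>. ennreal (s ^ (N - 2) * (if l s < \<beta> \<theta> then (\<beta> 1 - \<beta> \<theta>) * slope \<theta> else 0)) \<partial>R) =
      ennreal (s ^ (N - 2) * ((max 0 (\<beta> 1 - l s))\<^sup>2 / 2))"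
      by (rule nn_integral_has_bochner_integral) (use pos s in \<open>auto simp: space_restrict_space\<close>)
    moreover have "(\<integral>\<^sup>+\<theta>. ?K \<theta> s \<partial>R) = (\<integral>\<^sup>+\<theta>. ennreal (s ^ (N - 2) * (if l s < \<beta> \<theta> then (\<beta> 1 - \<beta> \<theta>) * slope \<theta> else 0)) \<partial>R)"
      by (intro nn_integral_cong) (auto simp: mult_ac)
    ultimately show ?thesis by simp
  qed
  show int: "integrable R (\<lambda>s. s ^ (N - 2) * ((max 0 (\<beta> 1 - l s))\<^sup>2 / 2))"
  proof (rule R.integrable_const_bound)
    show "AE s in R. norm (s ^ (N - 2) * ((max 0 (\<beta> 1 - l s))\<^sup>2 / 2)) \<le> (\<beta> 1)\<^sup>2 / 2"
    proof (subst AE_restrict_space_iff; (intro AE_I2 impI)?)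
      fix s :: real assume s: "s \<in> {0<..1}"
      have "s ^ (N - 2) * ((max 0 (\<beta> 1 - l s))\<^sup>2 / 2) \<le> 1 * ((\<beta> 1)\<^sup>2 / 2)"
        using s l_nonneg[of s] beta_nonneg[of 1]
        by (intro mult_mono divide_right_mono power_mono power_le_one) auto
      then show "norm (s ^ (N - 2) * ((max 0 (\<beta> 1 - l s))\<^sup>2 / 2)) \<le> (\<beta> 1)\<^sup>2 / 2"
        using s by simp
    qed simp
  qed measurable
  have "(\<integral>\<^sup>+\<theta>. (\<integral>\<^sup>+s. ?K \<theta> s \<partial>R) \<partial>R) = (\<integral>\<^sup>+s. (\<integral>\<^sup>+\<theta>. ?K \<theta> s \<partial>R) \<partial>R)"
    by (rule RR.Fubini'[symmetric]) measurable
  moreover have "(\<integral>\<^sup>+\<theta>. (\<integral>\<^sup>+s. ?K \<theta> s \<partial>R) \<partial>R) =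
      (\<integral>\<^sup>+\<theta>. ennreal ((\<beta> 1 - \<beta> \<theta>) * slope \<theta> * (win (\<beta> \<theta>) ^ (N - 1) / real (N - 1))) \<partial>R)"
    by (intro nn_integral_cong inner_s) (simp add: space_restrict_space)
  moreover have "(\<integral>\<^sup>+s. (\<integral>\<^sup>+\<theta>. ?K \<theta> s \<partial>R) \<partial>R) =
      (\<integral>\<^sup>+s. ennreal (s ^ (N - 2) * ((max 0 (\<beta> 1 - l s))\<^sup>2 / 2)) \<partial>R)"
    by (intro nn_integral_cong inner_t) (simp add: space_restrict_space)
  moreover have "\<dots> = ennreal (\<integral>s. s ^ (N - 2) * ((max 0 (\<beta> 1 - l s))\<^sup>2 / 2) \<partial>R)"
    by (rule nn_integral_eq_integral[OF int]) (simp add: AE_restrict_space_iff)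
  ultimately show "has_bochner_integral R
     (\<lambda>\<theta>. (\<beta> 1 - \<beta> \<theta>) * slope \<theta> * (win (\<beta> \<theta>) ^ (N - 1) / real (N - 1)))
     (\<integral>s. s ^ (N - 2) * ((max 0 (\<beta> 1 - l s))\<^sup>2 / 2) \<partial>R)"
    using pos
    by (intro has_bochner_integral_nn_integral)
      (auto simp: AE_restrict_space_iff win_nonneg intro!: integral_nonneg_AE AE_I2)
qed

section \<open>The two sides of the dual constraint for one buyer\<close>

text \<open>The weighted gain from deviating to \<beta>, with utilities in closed form: the
  deviation wins with probability \<open>win (\<beta> \<theta>) ^ (N - 1)\<close>, the prescribed
  bid with probability \<open>\<theta> ^ (N - 1)\<close>.\<close>

definition dual_term :: "real \<Rightarrow> real" where
  "dual_term \<theta> = (\<beta> 1 - \<beta> \<theta>) * (1 / \<theta>) *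
     (win (\<beta> \<theta>) ^ (N - 1) * (v \<theta> - \<beta> \<theta>) - \<theta> ^ (N - 1) * (v \<theta> - l \<theta>))"

text \<open>For types in [0, 1], the factor after \<open>\<theta> ^ (N - 2)\<close> is the Bregman
  distance from \<open>\<beta> \<theta>\<close> to \<open>l \<theta>\<close> of the convex function
  \<phi>(x) = \<open>(max 0 (\<beta> 1 - x))^2 / 2\<close>. The branches arise because \<phi> is
  quadratic up to \<open>\<beta> 1\<close> and zero beyond.\<close>

definition primal_term :: "real \<Rightarrow> real" where
  "primal_term \<theta> = \<theta> ^ (N - 2) *
     (if l \<theta> \<le> \<beta> 1 then (l \<theta> - \<beta> \<theta>)\<^sup>2 / 2
      else (\<beta> 1 - \<beta> \<theta>)\<^sup>2 / 2 + (\<beta> 1 - \<beta> \<theta>) * (l \<theta> - \<beta> 1))"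

text \<open>Both terms reduce to the same three integrals. Splitting
  \<open>v \<theta> - l \<theta>\<close> at \<open>\<beta> \<theta>\<close> writes
  \<open>dual_term\<close> as the deviation term for \<open>l\<close>, minus the one for \<beta>,
  minus \<open>?g\<close>, and \<open>integral_deviation\<close> turns the first two into the
  integrals of \<open>?L\<close> and \<open>?B\<close>. For \<open>primal_term\<close> the form
  \<open>?L - ?B - ?g\<close> holds pointwise, by expanding squares.\<close>

lemma dual_primal:
  shows integrable_dual_term: "integrable R dual_term"
    and integrable_primal_term: "integrable R primal_term"
    and integral_dual_term: "integral\<^sup>L R dual_term = integral\<^sup>L R primal_term"
proof -
  \<comment> \<open>When everyone plays \<beta>,
    \<open>own.win (\<beta> \<theta>) = \<theta>\<close>, so the payoff
    \<open>\<theta> ^ (N - 1) * (v \<theta> - \<beta> \<theta>)\<close> is itself of the form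
    covered by \<open>integral_deviation\<close>.\<close>
  interpret own: monotone_strategy N v \<beta>
    by unfold_locales (auto intro: strict_mono_beta beta_0)
  let ?g = "\<lambda>\<theta>. \<theta> ^ (N - 2) * ((\<beta> 1 - \<beta> \<theta>) * (\<beta> \<theta> - l \<theta>))"
  let ?L = "\<lambda>\<theta>. \<theta> ^ (N - 2) * ((max 0 (\<beta> 1 - l \<theta>))\<^sup>2 / 2)"
  let ?B = "\<lambda>\<theta>. \<theta> ^ (N - 2) * ((max 0 (\<beta> 1 - \<beta> \<theta>))\<^sup>2 / 2)"
  have g: "integrable R ?g"
  proof (rule R.integrable_const_bound)
    show "AE s in R. norm (?g s) \<le> \<beta> 1 * (\<beta> 1 + l 1)"
    proof (subst AE_restrict_space_iff; (intro AE_I2 impI)?)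
      fix s :: real assume s: "s \<in> {0<..1}"
      have "\<bar>s ^ (N - 2)\<bar> * (\<bar>\<beta> 1 - \<beta> s\<bar> * \<bar>\<beta> s - l s\<bar>) \<le> 1 * (\<beta> 1 * (\<beta> 1 + l 1))"
        using s l_nonneg[of s] l_le[of s 1] beta_nonneg[of s] beta_le[of s 1]
        by (intro mult_mono) (auto intro: power_le_one)
      then show "norm (?g s) \<le> \<beta> 1 * (\<beta> 1 + l 1)" by (simp add: abs_mult)
    qed simp
  qed measurable
  let ?D = "\<lambda>\<theta>. (\<beta> 1 - \<beta> \<theta>) * slope \<theta> * (win (\<beta> \<theta>) ^ (N - 1) / real (N - 1))
    - (\<beta> 1 - \<beta> \<theta>) * slope \<theta> * (own.win (\<beta> \<theta>) ^ (N - 1) / real (N - 1)) - ?g \<theta>"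
  have D: "has_bochner_integral R ?D (integral\<^sup>L R ?L - integral\<^sup>L R ?B - integral\<^sup>L R ?g)"
    by (intro has_bochner_integral_diff integral_deviation own.integral_deviation has_bochner_integral_integrable g)
  have D_eq: "dual_term \<theta> = ?D \<theta>" if "\<theta> \<in> space R" for \<theta>
  proof -
    have \<theta>: "0 < \<theta>" "\<theta> \<le> 1" using that by (auto simp: space_restrict_space)
    have "real (N - 1) \<noteq> 0" using N by simp
    then have sl: "slope \<theta> * (x / real (N - 1)) = (v \<theta> - \<beta> \<theta>) / \<theta> * x" for x
      using \<theta> by (simp add: slope_def)
    have ow: "own.win (\<beta> \<theta>) = \<theta>" using own.win_own[of \<theta>] \<theta> by simp
    show ?thesis
      unfolding dual_term_def mult.assoc sl ow power_N[of \<theta>]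
      using \<theta> by (simp add: field_simps)
  qed
  have P: "has_bochner_integral R (\<lambda>\<theta>. ?L \<theta> - ?B \<theta> - ?g \<theta>)
      (integral\<^sup>L R ?L - integral\<^sup>L R ?B - integral\<^sup>L R ?g)"
    by (intro has_bochner_integral_diff has_bochner_integral_integrable g integrable_deviation own.integrable_deviation)
  have P_eq: "primal_term \<theta> = ?L \<theta> - ?B \<theta> - ?g \<theta>" if "\<theta> \<in> space R" for \<theta>
  proof -
    have "\<beta> \<theta> \<le> \<beta> 1" using that beta_le[of \<theta> 1] by (auto simp: space_restrict_space)
    then show ?thesis
      unfolding primal_term_def right_diff_distrib[symmetric]
      by (intro arg_cong[where f = "(*) _"]) (auto simp: max_def power2_eq_square field_simps)
  qed
  have "has_bochner_integral R dual_term (integral\<^sup>L R ?L - integral\<^sup>L R ?B - integral\<^sup>L R ?g)"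
    using D by (subst has_bochner_integral_cong[OF refl D_eq refl])
  moreover have "has_bochner_integral R primal_term (integral\<^sup>L R ?L - integral\<^sup>L R ?B - integral\<^sup>L R ?g)"
    using P by (subst has_bochner_integral_cong[OF refl P_eq refl])
  ultimately show "integrable R dual_term" "integrable R primal_term"
    "integral\<^sup>L R dual_term = integral\<^sup>L R primal_term"
    by (auto simp: has_bochner_integral_iff)
qed

lemma primal_term_nonneg:
  assumes "0 \<le> \<theta>" "\<theta> \<le> 1"
  shows "0 \<le> primal_term \<theta>"
  using assms beta_le[of \<theta> 1] by (auto simp: primal_term_def)

text \<open>The power of \<theta> is positive, and for types below 1 the branch for bids above
  \<open>\<beta> 1\<close> is strictly positive. At type 1 that branch is 0 whatever the bid, which
  is why 1 is excluded.\<close>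

lemma primal_term_eq_0:
  assumes "0 < \<theta>" "\<theta> < 1" "primal_term \<theta> = 0"
  shows "l \<theta> = \<beta> \<theta>"
proof -
  have pos: "0 < \<beta> 1 - \<beta> \<theta>" using beta_less[of \<theta> 1] assms by simp
  show ?thesis
  proof (cases "l \<theta> \<le> \<beta> 1")
    case True
    then show ?thesis using assms by (simp add: primal_term_def)
  next
    case False
    then have "0 < (\<beta> 1 - \<beta> \<theta>)\<^sup>2 / 2 + (\<beta> 1 - \<beta> \<theta>) * (l \<theta> - \<beta> 1)"
      using pos by (intro add_pos_pos) auto
    then show ?thesis using assms False by (simp add: primal_term_def)
  qed
qed

section \<open>Expected utilities in closed form\<close>

text \<open>Ties have probability 0, because a strictly increasing \<open>l\<close> takes the value
  \<open>b\<close> at most once. Up to a null set, buyer \<open>i\<close> therefore wins exactly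
  when all N - 1 independent opponents bid below \<open>b\<close>.\<close>

lemma dev_utility_eq:
  assumes i: "i < N" and lam: "\<And>j. j < N \<Longrightarrow> lam j = l"
  shows "dev_utility N v i b lam t = win b ^ (N - 1) * (v t - b)"
proof -
  define P where "P = restrict_space lborel {0..1::real}"
  define J where "J = {..<N} - {i}"
  interpret P: prob_space P
    unfolding P_def by (rule prob_spaceI) (simp add: emeasure_restrict_space space_restrict_space)
  interpret PJ: finite_product_prob_space "\<lambda>_. P" J
    by unfold_locales (simp add: J_def)
  have cardJ: "card J = N - 1" using i by (simp add: J_def)
  have [measurable]: "l \<in> borel_measurable P"
  proof -
    have "mono_on {0..1} l" by (auto intro!: mono_onI l_le)
    from borel_measurable_mono_on_fnc[OF this] show ?thesis
      by (simp add: P_def measurable_def space_restrict_space sets_restrict_space)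
  qed
  let ?A = "{s \<in> {0..1}. l s < b}"
  have A: "?A \<in> sets P" using sets_win by (auto simp: P_def sets_restrict_space_iff)
  have mA: "P.prob ?A = win b" unfolding P_def win_def by (subst measure_restrict_space) auto
  \<comment> \<open>The number of winners is written as a finite sum over the opponents, which keeps
    the integrand visibly measurable in the type vector.\<close>
  have alloc: "allocation N i ((bids lam (\<theta>(i := t)))(i := b)) =
      (if \<forall>j\<in>J. l (\<theta> j) \<le> b then 1 / (1 + (\<Sum>j\<in>J. if l (\<theta> j) = b then 1 else 0)) else 0)" for \<theta>
  proof -
    let ?f = "(bids lam (\<theta>(i := t)))(i := b)"
    have f: "?f j = (if j = i then b else l (\<theta> j))" if "j < N" for j
      using lam[OF that] by (simp add: bids_def)
    have iw: "i \<in> winners N ?f \<longleftrightarrow> (\<forall>j\<in>J. l (\<theta> j) \<le> b)"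
    proof -
      have "bids lam (\<theta>(i := t)) j = l (\<theta> j)" if "j < N" "j \<noteq> i" for j
        using lam[OF that(1)] that(2) by (simp add: bids_def)
      then have "(\<forall>j<N. j \<noteq> i \<longrightarrow> bids lam (\<theta>(i := t)) j \<le> b) \<longleftrightarrow> (\<forall>j\<in>J. l (\<theta> j) \<le> b)"
        by (auto simp: J_def)
      moreover have "i \<in> winners N ?f \<longleftrightarrow> (\<forall>j<N. j \<noteq> i \<longrightarrow> bids lam (\<theta>(i := t)) j \<le> b)"
        using i by (auto simp: winners_iff)
      ultimately show ?thesis by simp
    qed
    have "winners N ?f = insert i {j \<in> J. l (\<theta> j) = b}" if le: "\<forall>j\<in>J. l (\<theta> j) \<le> b"
    proof (intro set_eqI iffI)
      fix j assume j: "j \<in> winners N ?f"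
      then have "j < N" "\<forall>k<N. ?f k \<le> ?f j"
        by (simp_all add: winners_iff del: fun_upd_apply)
      moreover from this i have "?f i \<le> ?f j" by blast
      ultimately have "j < N" "b \<le> ?f j" by simp_all
      then show "j \<in> insert i {j \<in> J. l (\<theta> j) = b}"
        using le f[of j] by (cases "j = i") (auto simp: J_def intro: antisym)
    next
      fix j assume "j \<in> insert i {j \<in> J. l (\<theta> j) = b}"
      then have j: "j < N" "?f j = b" using f[of j] i by (auto simp: J_def)
      have "?f k \<le> b" if "k < N" for k using f[OF that] le that by (auto simp: J_def)
      then show "j \<in> winners N ?f"
        using j by (simp add: winners_iff del: fun_upd_apply)
    qed
    moreover have "real (card (insert i {j \<in> J. l (\<theta> j) = b})) =
        1 + (\<Sum>j\<in>J. if l (\<theta> j) = b then 1 else 0)"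
      by (simp add: J_def sum.If_cases Int_def)
    ultimately show ?thesis using iw by (simp add: allocation_def del: fun_upd_apply)
  qed
  have U: "utility N i ((bids lam (\<theta>(i := t)))(i := b)) (v t) =
      (if \<forall>j\<in>J. l (\<theta> j) \<le> b then 1 / (1 + (\<Sum>j\<in>J. if l (\<theta> j) = b then 1 else 0)) else 0) * (v t - b)" for \<theta>
    unfolding utility_def alloc by simp
  have ne: "AE s in P. l s \<noteq> b"
  proof (cases "\<exists>c\<in>{0..1}. l c = b")
    case True
    then obtain c where c: "c \<in> {0..1}" "l c = b" by auto
    have "l s \<noteq> b" if "s \<in> {0..1}" "s \<noteq> c" for s
      using that c l_less[of s c] l_less[of c s] by (cases "s < c") auto
    then have "AE s in lborel. s \<in> {0..1} \<longrightarrow> l s \<noteq> b"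
      by (intro eventually_mono[OF AE_lborel_singleton[of c]]) blast
    then show ?thesis unfolding P_def by (subst AE_restrict_space_iff) auto
  next
    case False
    then show ?thesis unfolding P_def by (subst AE_restrict_space_iff) auto
  qed
  have "AE \<theta> in Pi\<^sub>M J (\<lambda>_. P). \<forall>j\<in>J. l (\<theta> j) \<noteq> b"
    by (intro AE_finite_allI AE_PiM_component ne P.prob_space_axioms) (simp add: J_def)
  then have ae: "AE \<theta> in Pi\<^sub>M J (\<lambda>_. P).
      (if \<forall>j\<in>J. l (\<theta> j) \<le> b then 1 / (1 + (\<Sum>j\<in>J. if l (\<theta> j) = b then 1 else 0)) else 0) * (v t - b) =
      indicator (\<Pi>\<^sub>E j\<in>J. ?A) \<theta> * (v t - b)"
  proof (rule AE_mp, intro AE_I2 impI)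
    fix \<theta> assume sp: "\<theta> \<in> space (Pi\<^sub>M J (\<lambda>_. P))" and ne: "\<forall>j\<in>J. l (\<theta> j) \<noteq> b"
    have "\<theta> \<in> (\<Pi>\<^sub>E j\<in>J. ?A) \<longleftrightarrow> (\<forall>j\<in>J. l (\<theta> j) < b)"
      using sp by (auto simp: space_PiM P_def space_restrict_space PiE_iff)
    moreover have "(\<forall>j\<in>J. l (\<theta> j) < b) \<longleftrightarrow> (\<forall>j\<in>J. l (\<theta> j) \<le> b)"
      using ne by (auto simp: less_le)
    moreover have "(\<Sum>j\<in>J. if l (\<theta> j) = b then 1 else 0) = (0::real)"
      using ne by (intro sum.neutral) auto
    ultimately show "(if \<forall>j\<in>J. l (\<theta> j) \<le> b then 1 / (1 + (\<Sum>j\<in>J. if l (\<theta> j) = b then 1 else 0)) else 0) * (v t - b) =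
      indicator (\<Pi>\<^sub>E j\<in>J. ?A) \<theta> * (v t - b)" by (simp add: indicator_def)
  qed
  have fJ: "finite J" by (simp add: J_def)
  have "dev_utility N v i b lam t =
      (\<integral>\<theta>. (if \<forall>j\<in>J. l (\<theta> j) \<le> b then 1 / (1 + (\<Sum>j\<in>J. if l (\<theta> j) = b then 1 else 0)) else 0) * (v t - b) \<partial>Pi\<^sub>M J (\<lambda>_. P))"
    unfolding dev_utility_def others_types_def U J_def P_def ..
  also have "\<dots> = (\<integral>\<theta>. indicator (\<Pi>\<^sub>E j\<in>J. ?A) \<theta> * (v t - b) \<partial>Pi\<^sub>M J (\<lambda>_. P))"
    by (rule integral_cong_AE[OF _ _ ae]) (use fJ A in measurable)
  also have "\<dots> = PJ.prob (\<Pi>\<^sub>E j\<in>J. ?A) * (v t - b)"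
    using A fJ by (subst integral_mult_left_zero) (simp add: sets_PiM_I_finite Int_absorb1 sets.sets_into_space)
  also have "PJ.prob (\<Pi>\<^sub>E j\<in>J. ?A) = win b ^ (N - 1)"
    using A by (subst PJ.prob_times) (simp_all only: mA prod_constant cardJ)
  finally show ?thesis .
qed

text \<open>Following the profile amounts to deviating to the own bid \<open>l t\<close>, for which
  \<open>win (l t) = t\<close>.\<close>

lemma exp_utility_eq:
  assumes i: "i < N" and lam: "\<And>j. j < N \<Longrightarrow> lam j = l" and t: "0 \<le> t" "t \<le> 1"
  shows "exp_utility N v i lam t = t ^ (N - 1) * (v t - l t)"
proof -
  have "(bids lam (\<theta>(i := t)))(i := l t) = bids lam (\<theta>(i := t))" for \<theta>
    using lam[OF i] by (auto simp: bids_def)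
  then have "exp_utility N v i lam t = dev_utility N v i (l t) lam t"
    by (simp add: exp_utility_def dev_utility_def)
  then show ?thesis using dev_utility_eq[OF i lam] win_own t by simp
qed

end

section \<open>Measures on sets of symmetric profiles\<close>

lemma sup_dist_ge:
  assumes L: "L \<subseteq> bid_profiles N bmax" and "lam \<in> L" "mu \<in> L" "i < N" "\<theta> \<in> {0..1}"
  shows "\<bar>lam i \<theta> - mu i \<theta>\<bar> \<le> sup_dist N L lam mu"
proof -
  have "\<bar>lam j t - mu j t\<bar> \<le> bmax" if "j < N" "t \<in> {0..1}" for j t
  proof -
    have "lam \<in> bid_profiles N bmax" "mu \<in> bid_profiles N bmax"
      using assms by auto
    then have "lam j t \<in> {0..bmax}" "mu j t \<in> {0..bmax}"
      using that unfolding bid_profiles_def by (meson PiE_mem lessThan_iff)+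
    then show ?thesis by auto
  qed
  then have "bdd_above ((\<lambda>(i, \<theta>). \<bar>lam i \<theta> - mu i \<theta>\<bar>) ` ({..<N} \<times> {0..1}))"
    by (intro bdd_aboveI[of _ bmax]) auto
  from cSUP_upper[OF _ this, of "(i, \<theta>)"] show ?thesis
    using assms by (simp add: sup_dist_def)
qed

lemma sets_sup_borel_openin:
  assumes "openin (Metric_space.mtopology L (sup_dist N L)) U" "0 < N" "L \<subseteq> bid_profiles N bmax"
  shows "U \<in> sets (sup_borel N L)"
proof -
  interpret Metric_space L "sup_dist N L" using assms Metric_space_sup_dist by blast
  have "{U. openin mtopology U} \<subseteq> Pow L" using openin_subset by fastforce
  then show ?thesis using assms by (simp add: sup_borel_def sets_measure_of)
qed

lemma space_sup_borel [simp]: "space (sup_borel N L) = L"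
  by (simp add: sup_borel_def space_measure_of_conv)

text \<open>Evaluation is 1-Lipschitz for the sup distance, so the ball of radius
  \<open>lam i \<theta> - a\<close> around \<open>lam\<close> stays in the superlevel set of
  \<open>a\<close>, which is thus open.\<close>

lemma measurable_sup_borel_eval:
  assumes L: "L \<subseteq> bid_profiles N bmax" and i: "i < N" and \<theta>: "\<theta> \<in> {0..1}"
  shows "(\<lambda>lam. lam i \<theta>) \<in> borel_measurable (sup_borel N L)"
proof -
  interpret Metric_space L "sup_dist N L" using i L by (intro Metric_space_sup_dist) auto
  have "openin mtopology {lam \<in> L. a < lam i \<theta>}" for a
    unfolding openin_mtopology
  proof (intro conjI allI impI)
    fix lam assume lam: "lam \<in> {lam \<in> L. a < lam i \<theta>}"
    have "mu \<in> {lam \<in> L. a < lam i \<theta>}" if "mu \<in> mball lam (lam i \<theta> - a)" for mu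
      using that lam sup_dist_ge[OF L _ _ i \<theta>, of lam mu] by auto
    then show "\<exists>r>0. mball lam r \<subseteq> {lam \<in> L. a < lam i \<theta>}"
      using lam by (intro exI[of _ "lam i \<theta> - a"]) auto
  qed auto
  then show ?thesis
    using sets_sup_borel_openin[OF _ _ L] i by (auto simp: borel_measurable_iff_greater)
qed

text \<open>Metric topologies are Hausdorff, so points are closed. This makes the event that the
  canonical profile is played measurable.\<close>

lemma singleton_in_sup_borel:
  assumes L: "L \<subseteq> bid_profiles N bmax" and N: "0 < N" and lam: "lam \<in> L"
  shows "{lam} \<in> sets (sup_borel N L)"
proof -
  interpret Metric_space L "sup_dist N L" using N L by (rule Metric_space_sup_dist)
  have "closedin mtopology {lam}"
    using Hausdorff_imp_t1_space[OF Hausdorff_space_mtopology] lam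
    by (simp add: closedin_t1_singleton)
  then have "openin mtopology (L - {lam})" by (simp add: closedin_def)
  from sets_sup_borel_openin[OF this N L] have "space (sup_borel N L) - (L - {lam}) \<in> sets (sup_borel N L)"
    by (rule sets.compl_sets)
  then show ?thesis using lam by (simp add: Diff_Diff_Int Int_absorb1)
qed

section \<open>The dual program over symmetric profiles\<close>

locale symmetric_profiles = first_price +
  fixes bmax :: real and \<Lambda> :: "profile set"
  assumes \<Lambda>: "\<Lambda> \<subseteq> bid_profiles N bmax"
    and canonical: "canonical_profile N v \<in> \<Lambda>"
    and symmetric: "\<And>lam i j. lam \<in> \<Lambda> \<Longrightarrow> i < N \<Longrightarrow> j < N \<Longrightarrow> lam i = lam j"
    and strict_mono: "\<And>lam i. lam \<in> \<Lambda> \<Longrightarrow> i < N \<Longrightarrow> strict_mono_on {0..1} (lam i)"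
    and continuous: "\<And>lam i. lam \<in> \<Lambda> \<Longrightarrow> i < N \<Longrightarrow> continuous_on {0<..1} (lam i)"
    and zero: "\<And>lam i. lam \<in> \<Lambda> \<Longrightarrow> i < N \<Longrightarrow> lam i 0 = 0"
    and bmax: "v 1 \<le> bmax"
begin

lemma pos_N: "0 < N" using N by simp

lemma monotone_strategy:
  assumes "lam \<in> \<Lambda>"
  shows "monotone_strategy N v (lam 0)"
  by unfold_locales (use assms pos_N strict_mono zero in auto)

text \<open>Here and in the next two abbreviations the strategy of buyer 0 represents the common
  strategy.\<close>

abbreviation win_of :: "profile \<Rightarrow> real \<Rightarrow> real" where
  "win_of lam \<equiv> monotone_strategy.win (lam 0)"

abbreviation dual :: "profile \<Rightarrow> real \<Rightarrow> real" where
  "dual lam \<equiv> monotone_strategy.dual_term N v (lam 0)"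

abbreviation primal :: "profile \<Rightarrow> real \<Rightarrow> real" where
  "primal lam \<equiv> monotone_strategy.primal_term N v (lam 0)"

lemma dual_integrand_eq:
  assumes lam: "lam \<in> \<Lambda>" and i: "i < N" and \<theta>: "\<theta> \<in> {0<..1}"
  shows "dual_integrand N v (\<lambda>\<theta>. \<beta> 1 - \<beta> \<theta>) i lam \<theta> = dual lam \<theta>"
proof -
  interpret monotone_strategy N v "lam 0" using lam by (rule monotone_strategy)
  have sym: "lam j = lam 0" if "j < N" for j using symmetric[OF lam that pos_N] .
  have "exp_utility N v i lam \<theta> = \<theta> ^ (N - 1) * (v \<theta> - lam 0 \<theta>)"
    using \<theta> by (intro exp_utility_eq[OF i sym]) auto
  then show ?thesis
    by (simp only: dual_integrand_def dual_term_def dev_utility_eq[OF i sym])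
qed

lemma alpha_eq:
  assumes lam: "lam \<in> \<Lambda>" and i: "i < N"
  shows "alpha N v i lam \<theta> = primal lam \<theta>"
proof -
  interpret monotone_strategy N v "lam 0" using lam by (rule monotone_strategy)
  show ?thesis
    using symmetric[OF lam i pos_N] by (simp add: alpha_def primal_term_def Let_def)
qed

lemma set_integral_R:
  fixes f :: "real \<Rightarrow> real"
  shows "(LBINT \<theta>:{0<..1}. f \<theta>) = integral\<^sup>L R f"
    and "set_integrable lborel {0<..1} f \<longleftrightarrow> integrable R f"
  by (simp_all add: set_lebesgue_integral_def set_integrable_def integral_restrict_space integrable_restrict_space)

text \<open>By \<open>integral_dual_term\<close> the two integrals agree for each buyer, so the
  constraint holds with equality at \<gamma> = 0. Uniform continuity is inherited from the compact
  interval [0, 1].\<close>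

lemma canonical_dual_feasible:
  "(\<lambda>\<theta>. \<beta> 1 - \<beta> \<theta>, 0) \<in> dual_feasible N v \<Lambda>"
proof -
  have "uniformly_continuous_on {0..1} (\<lambda>\<theta>. \<beta> 1 - \<beta> \<theta>)"
    by (intro compact_uniformly_continuous continuous_intros cont_beta) simp
  then have "uniformly_continuous_on {0<..1} (\<lambda>\<theta>. \<beta> 1 - \<beta> \<theta>)"
    unfolding uniformly_continuous_on_def by (meson atLeastAtMost_iff greaterThanAtMost_iff less_imp_le)
  moreover have "0 \<le> \<beta> 1 - \<beta> \<theta>" if "\<theta> \<in> {0<..1}" for \<theta>
    using that beta_le[of \<theta> 1] by simp
  moreover have "set_integrable lborel {0<..1} (dual_integrand N v (\<lambda>\<theta>. \<beta> 1 - \<beta> \<theta>) i lam)"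
    and "set_integrable lborel {0<..1} (alpha N v i lam)"
    and "(LBINT \<theta>:{0<..1}. dual_integrand N v (\<lambda>\<theta>. \<beta> 1 - \<beta> \<theta>) i lam \<theta>) = (LBINT \<theta>:{0<..1}. alpha N v i lam \<theta>)"
    if lam: "lam \<in> \<Lambda>" and i: "i < N" for lam i
  proof -
    interpret monotone_strategy N v "lam 0" using lam by (rule monotone_strategy)
    have d: "integrable R (dual_integrand N v (\<lambda>\<theta>. \<beta> 1 - \<beta> \<theta>) i lam) \<longleftrightarrow> integrable R dual_term"
      "integral\<^sup>L R (dual_integrand N v (\<lambda>\<theta>. \<beta> 1 - \<beta> \<theta>) i lam) = integral\<^sup>L R dual_term"
      using dual_integrand_eq[OF lam i]
      by (auto intro!: Bochner_Integration.integrable_cong Bochner_Integration.integral_cong simp: space_restrict_space)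
    show "set_integrable lborel {0<..1} (dual_integrand N v (\<lambda>\<theta>. \<beta> 1 - \<beta> \<theta>) i lam)"
      "set_integrable lborel {0<..1} (alpha N v i lam)"
      "(LBINT \<theta>:{0<..1}. dual_integrand N v (\<lambda>\<theta>. \<beta> 1 - \<beta> \<theta>) i lam \<theta>) = (LBINT \<theta>:{0<..1}. alpha N v i lam \<theta>)"
      using dual_primal unfolding set_integral_R d alpha_eq[OF lam i, abs_def] by auto
  qed
  ultimately show ?thesis by (simp add: dual_feasible_def)
qed

text \<open>A nonnegative function with integral 0 vanishes almost everywhere, so
  \<open>lam 0\<close> equals \<beta> almost everywhere on (0, 1). Continuity extends this to all of
  (0, 1], both strategies vanish at 0, and extensionality makes the profiles equal as
  functions.\<close>

lemma eq_canonical: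
  assumes lam: "lam \<in> \<Lambda>" and int: "integral\<^sup>L R (primal lam) = 0"
  shows "lam = canonical_profile N v"
proof -
  interpret monotone_strategy N v "lam 0" using lam by (rule monotone_strategy)
  have "AE \<theta> in R. primal_term \<theta> = 0"
    using int integral_nonneg_eq_0_iff_AE[OF integrable_primal_term] primal_term_nonneg
    by (simp add: AE_restrict_space_iff)
  then have "AE \<theta> in lborel. \<theta> \<in> {0<..1} \<longrightarrow> primal_term \<theta> = 0"
    by (simp add: AE_restrict_space_iff)
  then have ae: "AE \<theta> in lborel. 0 < \<theta> \<and> \<theta> < 1 \<longrightarrow> lam 0 \<theta> = \<beta> \<theta>"
    by (rule eventually_mono) (auto intro: primal_term_eq_0)
  have eq: "lam 0 t = \<beta> t" if t: "0 < t" "t \<le> 1" for t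
  proof (rule ccontr)
    assume ne: "lam 0 t \<noteq> \<beta> t"
    have "continuous_on {0<..1} (\<lambda>t. lam 0 t - \<beta> t)"
      by (intro continuous_intros continuous[OF lam pos_N] continuous_on_subset[OF cont_beta]) auto
    then obtain d where d: "d > 0"
      "\<And>x. x \<in> {0<..1} \<Longrightarrow> dist x t < d \<Longrightarrow>
        dist (lam 0 x - \<beta> x) (lam 0 t - \<beta> t) < \<bar>lam 0 t - \<beta> t\<bar>"
      using t ne unfolding continuous_on_iff
      by (metis greaterThanAtMost_iff zero_less_abs_iff right_minus_eq)
    \<comment> \<open>An interval to the left of \<open>t\<close> also serves for
      \<open>t = 1\<close>. On it \<open>lam 0 - \<beta>\<close> differs from its value at
      \<open>t\<close> by less than the size of that value, hence is never 0, although the interval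
      has positive measure.\<close>
    define a where "a = max 0 (t - d)"
    have "AE \<theta> in lborel. \<theta> \<notin> {a<..<t}"
      using ae
    proof (rule eventually_mono, intro notI)
      fix x assume x: "0 < x \<and> x < 1 \<longrightarrow> lam 0 x = \<beta> x" "x \<in> {a<..<t}"
      then show False using d(2)[of x] t by (auto simp: a_def dist_real_def)
    qed
    then have "emeasure lborel {a<..<t} = 0"
      using AE_iff_null_sets[of "{a<..<t}" lborel] by auto
    moreover have "a < t" using t d by (simp add: a_def)
    ultimately show False by simp
  qed
  have lam': "lam \<in> {..<N} \<rightarrow>\<^sub>E ({0..1} \<rightarrow>\<^sub>E {0..bmax})"
    and can': "canonical_profile N v \<in> {..<N} \<rightarrow>\<^sub>E ({0..1} \<rightarrow>\<^sub>E {0..bmax})"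
    using lam canonical \<Lambda> by (auto simp: bid_profiles_def)
  show ?thesis
  proof (rule PiE_ext[OF lam' can'])
    fix i assume i: "i \<in> {..<N}"
    show "lam i = canonical_profile N v i"
    proof (rule PiE_ext[OF PiE_mem[OF lam' i] PiE_mem[OF can' i]])
      fix t :: real assume "t \<in> {0..1}"
      then show "lam i t = canonical_profile N v i t"
        using i symmetric[OF lam, of i 0] pos_N eq[of t] l0 beta_0
        by (cases "t = 0") (auto simp: canonical_profile_def)
    qed
  qed
qed

text \<open>The supremum topology need not be separable, so joint measurability is obtained from rational
  types: by left-continuity, \<open>a < lam 0 t\<close> iff \<open>a < lam 0 q\<close> for some rational \<open>q \<le> t\<close>.\<close>

lemma measurable_bid:
  assumes \<sigma>: "sets \<sigma> = sets (sup_borel N \<Lambda>)"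
  shows "(\<lambda>(lam, t). lam 0 t) \<in> borel_measurable (\<sigma> \<Otimes>\<^sub>M R)"
proof -
  have sp: "space \<sigma> = \<Lambda>" using sets_eq_imp_space_eq[OF \<sigma>] by simp
  have ev [measurable]: "(\<lambda>lam. lam 0 q) \<in> borel_measurable \<sigma>" if "q \<in> {0..1}" for q
    using measurable_sup_borel_eval[OF \<Lambda> pos_N that] measurable_cong_sets[OF \<sigma> refl] by blast
  have "{w \<in> space (\<sigma> \<Otimes>\<^sub>M R). a < (case w of (lam, t) \<Rightarrow> lam 0 t)} =
      (\<Union>q\<in>\<rat> \<inter> {0<..1}. {lam \<in> space \<sigma>. a < lam 0 q} \<times> {t \<in> space R. q \<le> t})" (is "?l = ?r") for a
  proof (intro set_eqI iffI)
    fix w assume "w \<in> ?l"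
    then obtain lam t where w: "w = (lam, t)" "lam \<in> \<Lambda>" "0 < t" "t \<le> 1" "a < lam 0 t"
      by (cases w) (auto simp: space_pair_measure space_restrict_space sp)
    obtain d where d: "d > 0" "\<And>x. x \<in> {0<..1} \<Longrightarrow> dist x t < d \<Longrightarrow> dist (lam 0 x) (lam 0 t) < lam 0 t - a"
      using continuous[OF \<open>lam \<in> \<Lambda>\<close> pos_N] w unfolding continuous_on_iff
      by (metis greaterThanAtMost_iff diff_gt_0_iff_gt)
    obtain q where q: "q \<in> \<rat>" "max 0 (t - d) < q" "q < t"
      using Rats_dense_in_real[of "max 0 (t - d)" t] w d by auto
    then have "a < lam 0 q" using d(2)[of q] w by (auto simp: dist_real_def)
    then show "w \<in> ?r" using q w by (auto simp: sp space_restrict_space intro!: bexI[of _ q])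
  next
    fix w assume "w \<in> ?r"
    then obtain lam t q where w: "w = (lam, t)" "lam \<in> \<Lambda>" "0 < t" "t \<le> 1" "0 < q" "q \<le> t" "a < lam 0 q"
      by (auto simp: space_restrict_space sp)
    interpret monotone_strategy N v "lam 0" using \<open>lam \<in> \<Lambda>\<close> by (rule monotone_strategy)
    show "w \<in> ?l" using w l_le[of q t] by (auto simp: space_pair_measure space_restrict_space sp)
  qed
  moreover have "?r a \<in> sets (\<sigma> \<Otimes>\<^sub>M R)" for a
  proof (rule sets.countable_UN'')
    fix q :: real assume "q \<in> \<rat> \<inter> {0<..1}"
    then have "q \<in> {0..1}" by auto
    note [measurable] = ev[OF this]
    show "{lam \<in> space \<sigma>. a < lam 0 q} \<times> {t \<in> space R. q \<le> t} \<in> sets (\<sigma> \<Otimes>\<^sub>M R)"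
      by (rule pair_measureI) measurable
  qed (auto intro: countable_subset[OF _ countable_rat])
  ultimately show ?thesis by (simp add: borel_measurable_iff_greater)
qed

text \<open>As a generalised inverse of \<open>lam 0\<close>, the function \<open>win_of lam\<close>
  exceeds \<open>a\<close> at \<open>\<beta> t\<close> iff \<open>lam 0 q < \<beta> t\<close> for
  some rational \<open>q > a\<close> in [0, 1]. Each such condition is measurable, and there are
  countably many.\<close>

lemma measurable_win_profile:
  assumes \<sigma>: "sets \<sigma> = sets (sup_borel N \<Lambda>)"
  shows "(\<lambda>(lam, t). win_of lam (\<beta> t)) \<in> borel_measurable (\<sigma> \<Otimes>\<^sub>M R)"
proof -
  have sp: "space \<sigma> = \<Lambda>" using sets_eq_imp_space_eq[OF \<sigma>] by simp
  have ev [measurable]: "(\<lambda>lam. lam 0 q) \<in> borel_measurable \<sigma>" if "q \<in> {0..1}" for q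
    using measurable_sup_borel_eval[OF \<Lambda> pos_N that] measurable_cong_sets[OF \<sigma> refl] by blast
  have eq: "{w \<in> space (\<sigma> \<Otimes>\<^sub>M R). a < (case w of (lam, t) \<Rightarrow> win_of lam (\<beta> t))} =
      (\<Union>q\<in>\<rat> \<inter> {a<..} \<inter> {0..1}. {w \<in> space (\<sigma> \<Otimes>\<^sub>M R). fst w 0 q < \<beta> (snd w)})" (is "?l = ?r") for a
  proof (intro set_eqI iffI)
    fix w assume "w \<in> ?l"
    then obtain lam t where w: "w = (lam, t)" "lam \<in> \<Lambda>" "0 < t" "t \<le> 1" "a < win_of lam (\<beta> t)"
      by (cases w) (auto simp: space_pair_measure space_restrict_space sp)
    interpret monotone_strategy N v "lam 0" using \<open>lam \<in> \<Lambda>\<close> by (rule monotone_strategy)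
    obtain q where q: "q \<in> \<rat>" "a < q" "q \<in> {0..1}" "lam 0 q < \<beta> t"
    proof (cases "a < 0")
      case True
      \<comment> \<open>If the strategy jumps at 0, \<open>win_of lam (\<beta> t)\<close> may be 0,
        and no rational strictly between it and \<open>a\<close> lies in [0, 1]. Type 0 works, since
        it bids 0, which is below \<open>\<beta> t\<close>.\<close>
      then show ?thesis using that[of 0] l0 beta_pos[of t] w by simp
    next
      case False
      obtain q where q: "q \<in> \<rat>" "a < q" "q < win_of lam (\<beta> t)"
        using Rats_dense_in_real[OF w(5)] by auto
      then show ?thesis
        using that[of q] False win_le[of q "\<beta> t"] win_le_1[of "\<beta> t"] by force
    qed
    then show "w \<in> ?r" using w by (auto simp: sp space_restrict_space space_pair_measure)
  next
    fix w assume "w \<in> ?r"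
    then obtain lam t q where w: "w = (lam, t)" "lam \<in> \<Lambda>" "0 < t" "t \<le> 1" "q \<in> {0..1}" "a < q" "lam 0 q < \<beta> t"
      by (cases w) (auto simp: space_restrict_space space_pair_measure sp)
    interpret monotone_strategy N v "lam 0" using \<open>lam \<in> \<Lambda>\<close> by (rule monotone_strategy)
    show "w \<in> ?l" using w le_win[of q "\<beta> t"] by (auto simp: space_pair_measure space_restrict_space sp)
  qed
  have "?r a \<in> sets (\<sigma> \<Otimes>\<^sub>M R)" for a
  proof (rule sets.countable_UN'')
    fix q :: real assume "q \<in> \<rat> \<inter> {a<..} \<inter> {0..1}"
    then have "q \<in> {0..1}" by auto
    note [measurable] = ev[OF this]
    show "{w \<in> space (\<sigma> \<Otimes>\<^sub>M R). fst w 0 q < \<beta> (snd w)} \<in> sets (\<sigma> \<Otimes>\<^sub>M R)"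
      by measurable
  qed (auto intro: countable_subset[OF _ countable_rat])
  then show ?thesis unfolding borel_measurable_iff_greater eq by blast
qed

text \<open>This permits exchanging the expectation over profiles with the integral over types. The
  majorant \<open>?G\<close> is independent of the profile.\<close>

lemma integrable_dual:
  assumes \<sigma>: "sets \<sigma> = sets (sup_borel N \<Lambda>)" and "prob_space \<sigma>"
  shows "integrable (\<sigma> \<Otimes>\<^sub>M R) (\<lambda>(lam, t). dual lam t)"
proof -
  interpret \<sigma>: prob_space \<sigma> by fact
  interpret SR: pair_sigma_finite \<sigma> R ..
  have sp: "space \<sigma> = \<Lambda>" using sets_eq_imp_space_eq[OF \<sigma>] by simp
  note [measurable] = measurable_bid[OF \<sigma>] measurable_win_profile[OF \<sigma>]
  \<comment> \<open>The first summand bounds the deviation part, using that the winning probability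
    is at most 1. The second bounds the part with \<open>v t - lam 0 t\<close>, where one factor of
    \<open>t ^ (N - 1)\<close> absorbs \<open>1 / t\<close>.\<close>
  let ?G = "\<lambda>t. (\<beta> 1 - \<beta> t) * slope t / real (N - 1) + \<beta> 1 * (v 1 + bmax)"
  have "integrable R (\<lambda>t. (\<beta> 1 - \<beta> t) * slope t)"
  proof -
    \<comment> \<open>For \<open>c = 0\<close> every type in (0, 1] meets the condition, because
      \<beta> is positive there.\<close>
    have "integrable R (\<lambda>\<theta>. if 0 < \<beta> \<theta> then (\<beta> 1 - \<beta> \<theta>) * slope \<theta> else 0)"
      using integral_slope[of 0] by (simp add: has_bochner_integral_iff)
    then show ?thesis
      by (rule Bochner_Integration.integrable_cong[THEN iffD1, rotated 2])
        (auto simp: space_restrict_space beta_pos)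
  qed
  then have G: "integrable R ?G" by simp
  have GG: "integrable (\<sigma> \<Otimes>\<^sub>M R) (\<lambda>(lam, t). ?G t)"
  proof (rule SR.Fubini_integrable)
    show "(\<lambda>(lam, t). ?G t) \<in> borel_measurable (\<sigma> \<Otimes>\<^sub>M R)" by measurable
  qed (use G in auto)
  have meas: "(\<lambda>(lam, t). dual lam t) \<in> borel_measurable (\<sigma> \<Otimes>\<^sub>M R)"
  proof -
    have "(\<lambda>w. (\<beta> 1 - \<beta> (snd w)) * (1 / snd w) *
     ((case w of (lam, t) \<Rightarrow> win_of lam (\<beta> t)) ^ (N - 1) * (v (snd w) - \<beta> (snd w)) -
       snd w ^ (N - 1) * (v (snd w) - (case w of (lam, t) \<Rightarrow> lam 0 t))))
       \<in> borel_measurable (\<sigma> \<Otimes>\<^sub>M R)" (is "?f \<in> _")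
      by measurable
    moreover have "?f w = (case w of (lam, t) \<Rightarrow> dual lam t)" if "w \<in> space (\<sigma> \<Otimes>\<^sub>M R)" for w
    proof -
      have "fst w \<in> \<Lambda>" using that by (auto simp: space_pair_measure sp)
      then interpret monotone_strategy N v "fst w 0" by (rule monotone_strategy)
      show ?thesis by (cases w) (use dual_term_def in simp)
    qed
    ultimately show ?thesis by (rule measurable_cong[THEN iffD1, rotated])
  qed
  show ?thesis
  proof (rule Bochner_Integration.integrable_bound[OF GG meas], rule AE_I2)
    fix w assume "w \<in> space (\<sigma> \<Otimes>\<^sub>M R)"
    then obtain lam t where w: "w = (lam, t)" "lam \<in> \<Lambda>" "0 < t" "t \<le> 1"
      by (cases w) (auto simp: space_pair_measure space_restrict_space sp)
    interpret monotone_strategy N v "lam 0" using \<open>lam \<in> \<Lambda>\<close> by (rule monotone_strategy)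
    have "lam \<in> {..<N} \<rightarrow>\<^sub>E ({0..1} \<rightarrow>\<^sub>E {0..bmax})" using w \<Lambda> by (auto simp: bid_profiles_def)
    then have lt: "lam 0 t \<in> {0..bmax}" using w pos_N by (meson PiE_mem lessThan_iff atLeastAtMost_iff less_imp_le)
    have b: "0 \<le> \<beta> 1 - \<beta> t" "0 \<le> \<beta> t" "0 \<le> v t" "v t \<le> v 1" "0 < slope t"
      using w beta_le[of t 1] beta_nonneg[of t] v_nonneg[of t] v_le[of t 1] slope_pos[of t] by auto
    have n: "real (N - 1) > 0" using N by simp
    have "dual lam t = (\<beta> 1 - \<beta> t) * slope t / real (N - 1) * win_of lam (\<beta> t) ^ (N - 1)
        - (\<beta> 1 - \<beta> t) * (t ^ (N - 2) * (v t - lam 0 t))"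
      using w n unfolding dual_term_def slope_def power_N[of t] by (simp add: field_simps)
    moreover have "\<bar>(\<beta> 1 - \<beta> t) * slope t / real (N - 1) * win_of lam (\<beta> t) ^ (N - 1)\<bar>
        \<le> (\<beta> 1 - \<beta> t) * slope t / real (N - 1) * 1"
      unfolding abs_mult using b n win_nonneg[of "\<beta> t"] win_le_1[of "\<beta> t"]
      by (intro mult_mono) (auto intro: power_le_one)
    moreover have "\<bar>(\<beta> 1 - \<beta> t) * (t ^ (N - 2) * (v t - lam 0 t))\<bar> \<le> \<beta> 1 * (v 1 + bmax)"
    proof -
      have "\<bar>\<beta> 1 - \<beta> t\<bar> * (\<bar>t ^ (N - 2)\<bar> * \<bar>v t - lam 0 t\<bar>) \<le> \<beta> 1 * (1 * (v 1 + bmax))"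
        using b w lt by (intro mult_mono) (auto intro: power_le_one)
      then show ?thesis by (simp add: abs_mult)
    qed
    moreover have "\<bar>d\<bar> \<le> \<bar>x' + y'\<bar>"
      if "d = x - y" "\<bar>x\<bar> \<le> x' * 1" "\<bar>y\<bar> \<le> y'" for d x y x' y' :: real
      using that by linarith
    ultimately show "norm (case w of (lam, t) \<Rightarrow> dual lam t) \<le> norm (case w of (lam, t) \<Rightarrow> ?G t)"
      unfolding w real_norm_def prod.case mult_1 by blast
  qed
qed

text \<open>Weak duality at value 0. Since strategies are symmetric, the equilibrium constraints of
  buyer 0 against the deviations \<open>\<beta> t\<close> represent those of every buyer.\<close>

lemma continuous_BCCE_canonical:
  assumes bcce: "continuous_BCCE N v bmax \<Lambda> \<sigma>"
  shows "{canonical_profile N v} \<in> sets \<sigma>" and "measure \<sigma> {canonical_profile N v} = 1"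
proof -
  have \<sigma>: "sets \<sigma> = sets (sup_borel N \<Lambda>)" and "prob_space \<sigma>" and sp: "space \<sigma> = \<Lambda>"
    using bcce by (auto simp: continuous_BCCE_def)
  interpret \<sigma>: prob_space \<sigma> by fact
  interpret SR: pair_sigma_finite \<sigma> R ..
  note int = integrable_dual[OF \<sigma> \<open>prob_space \<sigma>\<close>]
  have nonpos: "(\<integral>lam. dual lam t \<partial>\<sigma>) \<le> 0" if t: "t \<in> {0<..1}" for t
  proof -
    \<comment> \<open>The equilibrium constraint is available only for bids up to
      \<open>bmax\<close>; \<open>\<beta> t\<close> qualifies because it is at most
      \<open>v t\<close>, hence at most \<open>v 1\<close>.\<close>
    have bt: "\<beta> t \<in> {0..bmax}"
      using t beta_nonneg[of t] beta_le_v[of t] v_le[of t 1] bmax by auto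
    have "(\<integral>lam. dual lam t \<partial>\<sigma>) = (\<integral>lam. dual_integrand N v (\<lambda>\<theta>. \<beta> 1 - \<beta> \<theta>) 0 lam t \<partial>\<sigma>)"
      by (intro Bochner_Integration.integral_cong refl) (simp add: sp dual_integrand_eq[OF _ pos_N t])
    also have "\<dots> = (\<beta> 1 - \<beta> t) * (1 / t) *
        (\<integral>lam. (dev_utility N v 0 (\<beta> t) lam t - exp_utility N v 0 lam t) \<partial>\<sigma>)"
      unfolding dual_integrand_def by (rule integral_mult_right_zero)
    also have "\<dots> \<le> 0"
    proof (rule mult_nonneg_nonpos)
      show "0 \<le> (\<beta> 1 - \<beta> t) * (1 / t)" using t beta_le[of t 1] by simp
      have "t \<in> {0..1}" using t by simp
      then show "(\<integral>lam. (dev_utility N v 0 (\<beta> t) lam t - exp_utility N v 0 lam t) \<partial>\<sigma>) \<le> 0"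
        using bcce bt pos_N unfolding continuous_BCCE_def by blast
    qed
    finally show ?thesis .
  qed
  let ?A = "\<lambda>lam. integral\<^sup>L R (primal lam)"
  have A: "integral\<^sup>L R (dual lam) = ?A lam" "0 \<le> ?A lam" if "lam \<in> \<Lambda>" for lam
  proof -
    interpret monotone_strategy N v "lam 0" using that by (rule monotone_strategy)
    show "integral\<^sup>L R (dual lam) = ?A lam" by (rule integral_dual_term)
    show "0 \<le> ?A lam"
      by (rule integral_nonneg_AE) (auto simp: AE_restrict_space_iff primal_term_nonneg)
  qed
  have "integrable \<sigma> (\<lambda>lam. integral\<^sup>L R (dual lam))"
    using SR.integrable_fst'[OF int] by simp
  moreover have "integrable \<sigma> (\<lambda>lam. integral\<^sup>L R (dual lam)) \<longleftrightarrow> integrable \<sigma> ?A"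
    by (rule Bochner_Integration.integrable_cong[OF refl]) (simp only: sp A)
  ultimately have intA: "integrable \<sigma> ?A" by simp
  have "integral\<^sup>L \<sigma> ?A = (\<integral>lam. (\<integral>t. dual lam t \<partial>R) \<partial>\<sigma>)"
    by (rule Bochner_Integration.integral_cong[OF refl]) (simp only: sp A)
  also have "\<dots> = (\<integral>t. (\<integral>lam. dual lam t \<partial>\<sigma>) \<partial>R)"
    by (rule SR.Fubini_integral[OF int, symmetric])
  also have "\<dots> \<le> 0"
  proof -
    have "0 \<le> (\<integral>t. - (\<integral>lam. dual lam t \<partial>\<sigma>) \<partial>R)"
      by (rule Bochner_Integration.integral_nonneg) (use nonpos in \<open>simp add: space_restrict_space\<close>)
    then show ?thesis by simp
  qed
  finally have "integral\<^sup>L \<sigma> ?A \<le> 0" .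
  moreover have "0 \<le> integral\<^sup>L \<sigma> ?A"
    by (rule Bochner_Integration.integral_nonneg) (simp only: sp A)
  ultimately have "integral\<^sup>L \<sigma> ?A = 0" by simp
  moreover have "AE lam in \<sigma>. 0 \<le> ?A lam"
    by (rule AE_I2) (simp only: sp A)
  ultimately have "AE lam in \<sigma>. ?A lam = 0"
    using integral_nonneg_eq_0_iff_AE[OF intA] by blast
  then have ae: "AE lam in \<sigma>. lam \<in> {canonical_profile N v}"
  proof (rule AE_mp, intro AE_I2 impI)
    fix lam assume "lam \<in> space \<sigma>" "?A lam = 0"
    then show "lam \<in> {canonical_profile N v}"
      unfolding sp using eq_canonical by blast
  qed
  show sing: "{canonical_profile N v} \<in> sets \<sigma>"
    unfolding \<sigma> using \<Lambda> pos_N canonical by (rule singleton_in_sup_borel)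
  show "measure \<sigma> {canonical_profile N v} = 1"
    using ae sing by (simp add: \<sigma>.prob_eq_1)
qed

end

theorem theorem4p5:
  fixes N :: nat and p v :: "real \<Rightarrow> real" and bmax M :: real
    and \<Lambda> :: "(nat \<Rightarrow> real \<Rightarrow> real) set"
  assumes "2 \<le> N"
    and "quantile_valuation p v"
    and "{0..v 1} \<subseteq> {0..bmax}"
    and "0 < M"
    and "\<Lambda> \<subseteq> bid_profiles N bmax"
    and "canonical_profile N v \<in> \<Lambda>"
    and "\<And>lam i j. lam \<in> \<Lambda> \<Longrightarrow> i < N \<Longrightarrow> j < N \<Longrightarrow> lam i = lam j"
    and "\<And>lam i. lam \<in> \<Lambda> \<Longrightarrow> i < N \<Longrightarrow> strict_mono_on {0..1} (lam i)"
    and "\<And>lam i. lam \<in> \<Lambda> \<Longrightarrow> i < N \<Longrightarrow> lam i differentiable_on {0<..1}"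
    and "\<And>lam i. lam \<in> \<Lambda> \<Longrightarrow> i < N \<Longrightarrow> lam i 0 = 0"
    and "\<And>lam i \<theta>. lam \<in> \<Lambda> \<Longrightarrow> i < N \<Longrightarrow> \<theta> \<in> {0..1} \<Longrightarrow> lam i \<theta> < M"
  shows "(\<lambda>\<theta>. canonical_bid N v 1 - canonical_bid N v \<theta>, 0) \<in> dual_feasible N v \<Lambda>
    \<and> dual_objective (\<lambda>\<theta>. canonical_bid N v 1 - canonical_bid N v \<theta>, 0) = 0
    \<and> (\<forall>\<sigma>. continuous_BCCE N v bmax \<Lambda> \<sigma> \<longrightarrow>
          {canonical_profile N v} \<in> sets \<sigma> \<and> measure \<sigma> {canonical_profile N v} = 1)"
proof -
  have v: "bij_betw v {0..1} {0..v 1}" "continuous_on {0..1} v" "strict_mono_on {0..1} v"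
    using assms(2) by (auto simp: quantile_valuation_def)
  have v1: "0 \<le> v 1" and "v 0 \<ge> 0"
    using bij_betwE[OF v(1)] by auto
  \<comment> \<open>As \<open>v\<close> maps onto [0, v(1)], the value 0 is attained. It is attained
    at 0, since at a positive type strict monotonicity would make \<open>v 0\<close>
    negative.\<close>
  then obtain x where "x \<in> {0..1}" "v x = 0"
    using v(1) by (metis atLeastAtMost_iff bij_betw_imp_surj_on imageE order_refl)
  then have v0: "v 0 = 0"
    using strict_mono_onD[OF v(3), of 0 x] \<open>v 0 \<ge> 0\<close> by (cases "x = 0") auto
  interpret symmetric_profiles N v bmax \<Lambda>
  proof
    show "lam i = lam j" if "lam \<in> \<Lambda>" "i < N" "j < N" for lam i j
      using assms(7) that .
    show "continuous_on {0<..1} (lam i)" if "lam \<in> \<Lambda>" "i < N" for lam i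
      using assms(9)[OF that] by (rule differentiable_imp_continuous_on)
    show "strict_mono_on {0..1} (lam i)" "lam i 0 = 0" if "lam \<in> \<Lambda>" "i < N" for lam i
      using assms(8)[OF that] assms(10)[OF that] .
    show "v 1 \<le> bmax" using assms(3) v1 by auto
    show "2 \<le> N" "v 0 = 0" "continuous_on {0..1} v" "strict_mono_on {0..1} v"
      "\<Lambda> \<subseteq> bid_profiles N bmax" "canonical_profile N v \<in> \<Lambda>"
      by (fact assms(1) v0 v(2) v(3) assms(5) assms(6))+
  qed
  show ?thesis
    using canonical_dual_feasible continuous_BCCE_canonical by (auto simp: dual_objective_def)
qed

end
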